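(* Let $m\geq 2$ and $n\geq m+2$ be integers with $n(m-2)>m^2-2$. Let $F$ be a positive smooth Morse function on the torus $T^m$, let $\epsilon>0$ be sufficiently small (depending on the $C^2$ norm of $\log F$), and let $$g=\epsilon^2F^2h+F^{-2\frac{n-m}{m-1}}\sum_{i=1}^m dx_i^2$$ be the metric on $S^{n-m}\times T^m$, where $h$ is the standard (round, unit) metric on $S^{n-m}$. Then there exists a small perturbation of $g$ that satisfies $\mathcal{C}_m>0$ strictly; that is, every $C^\infty$-neighborhood of $g$ contains a smooth Riemannian metric on $S^{n-m}\times T^m$ with $\mathcal{C}_m>0$ everywhere.
   Context: $T^m=\mathbb{R}^m/\mathbb{Z}^m$ is the torus with its natural (periodic) coordinates $x_1,\dots,x_m$; norms of derivatives of $\log F$ are taken in these coordinates. For a Riemannian $n$-manifold, $1\leq m\leq n-1$, and an orthonormal frame $\{e_1,\dots,e_n\}$ at a point, the $m$-intermediate curvature is $$\mathcal{C}_m(e_1,\dots,e_m):=\sum_{p=1}^m\sum_{q=p+1}^n R(e_p,e_q,e_q,e_p),$$ where $R(e_p,e_q,e_q,e_p)$ is the sectional curvature of the plane spanned by $e_p,e_q$. The metric satisfies $\mathcal{C}_m>0$ if $\mathcal{C}_m(e_1,\dots,e_m)>0$ for every orthonormal frame at every point. *)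

theory Defs
  imports "HOL-Analysis.Analysis"
begin

section \<open>Iterated derivatives and smoothness on Euclidean space\<close>

definition dir_deriv :: "'a::euclidean_space \<Rightarrow> ('a \<Rightarrow> 'b::real_normed_vector) \<Rightarrow> 'a \<Rightarrow> 'b" where
  "dir_deriv v f z = frechet_derivative f (at z) v"

primrec iter_deriv :: "'a::euclidean_space list \<Rightarrow> ('a \<Rightarrow> 'b::real_normed_vector) \<Rightarrow> 'a \<Rightarrow> 'b" where
  "iter_deriv [] f = f"
| "iter_deriv (v # vs) f = dir_deriv v (iter_deriv vs f)"

text \<open>
  \<open>C\<^sup>\<infinity>\<close> on the whole space: each iterated directional derivative is again (Frechet) differentiable,
  so all of them are continuous.
\<close>

definition smooth :: "('a::euclidean_space \<Rightarrow> 'b::real_normed_vector) \<Rightarrow> bool" where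
  "smooth f \<longleftrightarrow> (\<forall>vs z. iter_deriv vs f differentiable (at z))"


section \<open>Curvature of a metric on Euclidean space\<close>

text \<open>
  A metric in one coordinate chart is a function \<open>G\<close>, where \<open>G z\<close> is the inner product on the
  tangent space at \<open>z\<close>. Coordinate vector fields are constant, so their Lie brackets vanish and
  the Koszul formula for the Levi-Civita connection reduces to the one below;
  \<open>christoffel G z a b\<close> is \<open>\<nabla>\<^sub>a b\<close> at \<open>z\<close> for constant vector fields \<open>a\<close>, \<open>b\<close>.
\<close>

definition christoffel ::
    "('a::euclidean_space \<Rightarrow> 'a \<Rightarrow> 'a \<Rightarrow> real) \<Rightarrow> 'a \<Rightarrow> 'a \<Rightarrow> 'a \<Rightarrow> 'a" where
  "christoffel G z a b = (THE w. \<forall>c. 2 * G z w c =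
      dir_deriv a (\<lambda>y. G y b c) z + dir_deriv b (\<lambda>y. G y a c) z - dir_deriv c (\<lambda>y. G y a b) z)"

text \<open>
  \<open>R(a,b)c = \<nabla>\<^sub>a \<nabla>\<^sub>b c - \<nabla>\<^sub>b \<nabla>\<^sub>a c\<close> for constant vector fields, and
  \<open>R(a,b,c,d) = \<langle>R(a,b)c, d\<rangle>\<close>; hence \<open>R(a,b,b,a)\<close> is the sectional curvature when \<open>a\<close>, \<open>b\<close> are
  orthonormal.
\<close>

definition riemann_endo ::
    "('a::euclidean_space \<Rightarrow> 'a \<Rightarrow> 'a \<Rightarrow> real) \<Rightarrow> 'a \<Rightarrow> 'a \<Rightarrow> 'a \<Rightarrow> 'a \<Rightarrow> 'a" where
  "riemann_endo G z a b c =
      dir_deriv a (\<lambda>y. christoffel G y b c) z - dir_deriv b (\<lambda>y. christoffel G y a c) z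
      + christoffel G z a (christoffel G z b c) - christoffel G z b (christoffel G z a c)"

definition riemann ::
    "('a::euclidean_space \<Rightarrow> 'a \<Rightarrow> 'a \<Rightarrow> real) \<Rightarrow> 'a \<Rightarrow> 'a \<Rightarrow> 'a \<Rightarrow> 'a \<Rightarrow> 'a \<Rightarrow> real" where
  "riemann G z a b c d = G z (riemann_endo G z a b c) d"

definition orthonormal_frame ::
    "('a::euclidean_space \<Rightarrow> 'a \<Rightarrow> 'a \<Rightarrow> real) \<Rightarrow> 'a \<Rightarrow> (nat \<Rightarrow> 'a) \<Rightarrow> bool" where
  "orthonormal_frame G z e \<longleftrightarrow>
      (\<forall>i\<in>{1..DIM('a)}. \<forall>j\<in>{1..DIM('a)}. G z (e i) (e j) = (if i = j then 1 else 0))"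

definition intermediate_curvature ::
    "nat \<Rightarrow> ('a::euclidean_space \<Rightarrow> 'a \<Rightarrow> 'a \<Rightarrow> real) \<Rightarrow> 'a \<Rightarrow> (nat \<Rightarrow> 'a) \<Rightarrow> real" where
  "intermediate_curvature m G z e =
      (\<Sum>p=1..m. \<Sum>q=p+1..DIM('a). riemann G z (e p) (e q) (e q) (e p))"


section \<open>The torus\<close>

definition lattice_rel :: "real ^ 'm \<Rightarrow> real ^ 'm \<Rightarrow> bool" where
  "lattice_rel x y \<longleftrightarrow> (\<forall>i. x $ i - y $ i \<in> \<int>)"

lemma equivp_lattice_rel: "equivp lattice_rel"
proof (rule equivpI)
  show "reflp lattice_rel"
    by (simp add: reflp_def lattice_rel_def)
  show "symp lattice_rel"
    unfolding symp_def lattice_rel_def by (metis Ints_minus minus_diff_eq)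
  show "transp lattice_rel"
    unfolding transp_def lattice_rel_def by (metis Ints_add diff_add_cancel add_diff_eq)
qed

quotient_type 'm torus = "real ^ ('m::finite)" / lattice_rel
  morphisms rep_torus torus_proj
  by (rule equivp_lattice_rel)

definition in_coords :: "('m torus \<Rightarrow> real) \<Rightarrow> real ^ 'm::finite \<Rightarrow> real" where
  "in_coords F x = F (torus_proj x)"

definition smooth_torus :: "('m::finite torus \<Rightarrow> real) \<Rightarrow> bool" where
  "smooth_torus F \<longleftrightarrow> smooth (in_coords F)"

definition morse_torus :: "('m::finite torus \<Rightarrow> real) \<Rightarrow> bool" where
  "morse_torus F \<longleftrightarrow> smooth_torus F \<and>
     (\<forall>x. (\<forall>i. iter_deriv [axis i 1] (in_coords F) x = 0) \<longrightarrow>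
        det (\<chi> i j. iter_deriv [axis i 1, axis j 1] (in_coords F) x) \<noteq> 0)"

text \<open>
  For smooth \<open>F\<close> the set is bounded because \<open>in_coords F\<close> is periodic, so the supremum is finite.
\<close>

definition C2_norm :: "('m::finite torus \<Rightarrow> real) \<Rightarrow> real" where
  "C2_norm F = Sup {\<bar>iter_deriv vs (in_coords F) x\<bar> | vs x. set vs \<subseteq> Basis \<and> length vs \<le> 2}"


section \<open>The product of a sphere and the torus\<close>

text \<open>
  With \<open>CARD('k) = k\<close>, the sphere \<open>S\<^sup>k\<close> is the unit sphere of \<open>\<real>\<^sup>k \<times> \<real>\<close>. Its tangent space at \<open>p\<close> is
  the orthogonal complement of \<open>p\<close>, and the tangent spaces of the torus are identified with
  \<open>\<real>\<^sup>m\<close> by the periodic coordinates. A 2-tensor field is a function on points and pairs of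
  tangent vectors; its values off the manifold and off the tangent spaces are irrelevant.
\<close>

type_synonym ('k, 'm) point = "((real ^ 'k) \<times> real) \<times> 'm torus"
type_synonym ('k, 'm) tangent = "((real ^ 'k) \<times> real) \<times> (real ^ 'm)"
type_synonym ('k, 'm) coord = "(real ^ 'k) \<times> (real ^ 'm)"
type_synonym ('k, 'm) tensor2 =
  "('k, 'm) point \<Rightarrow> ('k, 'm) tangent \<Rightarrow> ('k, 'm) tangent \<Rightarrow> real"

definition sphere_torus :: "('k::finite, 'm::finite) point set" where
  "sphere_torus = sphere 0 1 \<times> UNIV"

definition tangent_space :: "('k::finite, 'm::finite) point \<Rightarrow> ('k, 'm) tangent set" where
  "tangent_space P = {u. fst u \<bullet> fst P = 0}"

text \<open>
  Inverse stereographic projection from the pole \<open>(0, s)\<close>, for \<open>s = 1\<close> and \<open>s = -1\<close>. Together with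
  the projection \<open>\<real>\<^sup>m \<rightarrow> T\<^sup>m\<close> these give two local diffeomorphisms \<open>\<real>\<^sup>k \<times> \<real>\<^sup>m \<rightarrow> S\<^sup>k \<times> T\<^sup>m\<close> whose
  images cover the manifold.
\<close>

definition stereo_inv :: "real \<Rightarrow> real ^ 'k \<Rightarrow> (real ^ 'k::finite) \<times> real" where
  "stereo_inv s y = ((2 / (1 + y \<bullet> y)) *\<^sub>R y, s * (y \<bullet> y - 1) / (y \<bullet> y + 1))"

definition chart_point :: "real \<Rightarrow> ('k::finite, 'm::finite) coord \<Rightarrow> ('k, 'm) point" where
  "chart_point s z = (stereo_inv s (fst z), torus_proj (snd z))"

definition chart_deriv ::
    "real \<Rightarrow> ('k::finite, 'm::finite) coord \<Rightarrow> ('k, 'm) coord \<Rightarrow> ('k, 'm) tangent" where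
  "chart_deriv s z a = (frechet_derivative (stereo_inv s) (at (fst z)) (fst a), snd a)"

definition pullback :: "real \<Rightarrow> ('k::finite, 'm::finite) tensor2 \<Rightarrow>
    ('k, 'm) coord \<Rightarrow> ('k, 'm) coord \<Rightarrow> ('k, 'm) coord \<Rightarrow> real" where
  "pullback s g z a b = g (chart_point s z) (chart_deriv s z a) (chart_deriv s z b)"

definition riemannian_metric :: "('k::finite, 'm::finite) tensor2 \<Rightarrow> bool" where
  "riemannian_metric g \<longleftrightarrow>
     (\<forall>P\<in>sphere_torus. \<forall>u\<in>tangent_space P. \<forall>v\<in>tangent_space P. \<forall>w\<in>tangent_space P. \<forall>c.
        g P u v = g P v u \<and> g P (u + v) w = g P u w + g P v w \<and> g P (c *\<^sub>R u) v = c * g P u v \<and>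
        (u \<noteq> 0 \<longrightarrow> g P u u > 0)) \<and>
     (\<forall>s\<in>{1, -1}. \<forall>a b. smooth (\<lambda>z. pullback s g z a b))"

text \<open>
  Every orthonormal frame at every point of the manifold is represented by one in one of the two
  charts.
\<close>

definition positive_intermediate_curvature ::
    "nat \<Rightarrow> ('k::finite, 'm::finite) tensor2 \<Rightarrow> bool" where
  "positive_intermediate_curvature m g \<longleftrightarrow>
     (\<forall>s\<in>{1, -1}. \<forall>z e. orthonormal_frame (pullback s g) z e \<longrightarrow>
        intermediate_curvature m (pullback s g) z e > 0)"

text \<open>
  Basic \<open>C\<^sup>\<infinity>\<close>-neighborhoods of \<open>g\<close>: in both charts all partial derivatives of order at most \<open>N\<close> of
  the components are within \<open>d\<close> of those of \<open>g\<close> on the compact set \<open>K\<close>.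
\<close>

definition close_metrics :: "nat \<Rightarrow> ('k::finite, 'm::finite) coord set \<Rightarrow> real \<Rightarrow>
    ('k, 'm) tensor2 \<Rightarrow> ('k, 'm) tensor2 set" where
  "close_metrics N K d g = {g'. riemannian_metric g' \<and>
     (\<forall>s\<in>{1, -1}. \<forall>z\<in>K. \<forall>a\<in>Basis. \<forall>b\<in>Basis. \<forall>vs. set vs \<subseteq> Basis \<and> length vs \<le> N \<longrightarrow>
        \<bar>iter_deriv vs (\<lambda>y. pullback s g' y a b) z - iter_deriv vs (\<lambda>y. pullback s g y a b) z\<bar> < d)}"

definition Cinf_neighborhood ::
    "('k::finite, 'm::finite) tensor2 \<Rightarrow> ('k, 'm) tensor2 set \<Rightarrow> bool" where
  "Cinf_neighborhood g U \<longleftrightarrow> (\<exists>N K d. compact K \<and> d > 0 \<and> close_metrics N K d g \<subseteq> U)"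


section \<open>The doubly warped metric\<close>

text \<open>
  The round metric is the restriction of the ambient inner product to the tangent spaces.
\<close>

definition round_metric ::
    "(real ^ 'k::finite) \<times> real \<Rightarrow> (real ^ 'k) \<times> real \<Rightarrow> (real ^ 'k) \<times> real \<Rightarrow> real" where
  "round_metric p u v = u \<bullet> v"

definition warped_metric ::
    "nat \<Rightarrow> nat \<Rightarrow> real \<Rightarrow> ('m::finite torus \<Rightarrow> real) \<Rightarrow> ('k::finite, 'm) tensor2" where
  "warped_metric n m \<epsilon> F = (\<lambda>(p, q) (u, x) (v, y).
     \<epsilon>\<^sup>2 * (F q)\<^sup>2 * round_metric p u v
     + F q powr (- 2 * ((real n - real m) / (real m - 1))) * (\<Sum>i\<in>UNIV. x $ i * y $ i))"

end

theory Submission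
  imports Defs
begin

text \<open>
  Put \<open>k = n - m\<close>, \<open>\<phi> = ln F\<close> and \<open>\<beta> = k / (m - 1)\<close>, so that the metric is
  \<open>\<epsilon>\<^sup>2 * exp (2 * \<phi>) * h + exp (2 * \<psi>) * dx\<^sup>2\<close> with \<open>\<psi> = - \<beta> * \<phi>\<close>. Its curvature has three parts
  (\<open>riemann_G\<close>). Planes tangent to the sphere have curvature
  \<open>\<lambda> = 1 / (\<epsilon>\<^sup>2 * F\<^sup>2) - exp (- 2 * \<psi>) * |grad \<phi>|\<^sup>2\<close>, mixed planes are governed by the Hessian of \<open>F\<close>, and planes
  tangent to the torus by the Schouten tensor of the conformally flat metric on the torus. No other
  terms occur.

  If the first \<open>m\<close> vectors of the frame span the tangent space of the torus, the choice of \<open>\<beta>\<close> makes all second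
  derivatives cancel and the \<open>m\<close>-intermediate curvature is a multiple of \<open>exp (- 2 * \<psi>) * |grad \<phi>|\<^sup>2\<close>
  (\<open>trace_curvature_eq\<close>). The factor \<open>k * ((m - 2) * \<beta> / 2 - 1)\<close> is positive if and only if
  \<open>n * (m - 2) > m\<^sup>2 - 2\<close>. For other frames let \<open>w\<close> be the sum of the squared lengths of the sphere
  components of the first \<open>m\<close> vectors. The sphere contributes at least \<open>(k - 1) / 2 * \<lambda> * w\<close>, and all other terms
  change by at most a constant times \<open>w\<close> that depends only on the dimensions and the \<open>C\<^sup>2\<close> norm of \<open>\<phi>\<close>. So for small \<open>\<epsilon>\<close> it is
  enough to make the value on frames of the first kind positive (\<open>frame_curvature_pos\<close>).

  That value vanishes at the critical points of \<open>F\<close>. Multiply the torus part of the metric by \<open>1 - t * \<theta>\<close> with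
  \<open>\<theta> = |grad F|\<^sup>2\<close>. To first order in \<open>t\<close> the value changes by a positive multiple of \<open>t\<close> times the Laplacian of
  \<open>\<theta>\<close>, and at a critical point this Laplacian is \<open>2 * |Hess F|\<^sup>2\<close>, which is positive because \<open>F\<close> is a Morse
  function (\<open>laplacian_grad_sq_pos\<close>). By compactness of the torus the value is then positive everywhere
  for all small \<open>t > 0\<close> (\<open>exists_perturbation\<close>). The perturbed metric is affine in \<open>t\<close>, so it lies in any given
  \<open>C\<^sup>\<infinity>\<close>-neighborhood of the original one when \<open>t\<close> is small (\<open>linear_perturbation_close\<close>).
\<close>


section \<open>Smooth functions\<close>

lemma dir_deriv_eqI: "(f has_derivative f') (at z) \<Longrightarrow> dir_deriv v f z = f' v"
  unfolding dir_deriv_def by (simp add: frechet_derivative_at [symmetric])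

lemma has_derivative_dir_deriv:
  "f differentiable (at z) \<Longrightarrow> (f has_derivative (\<lambda>v. dir_deriv v f z)) (at z)"
  unfolding dir_deriv_def by (simp add: frechet_derivative_works)

lemma linear_dir_deriv: "f differentiable (at z) \<Longrightarrow> linear (\<lambda>v. dir_deriv v f z)"
  using has_derivative_dir_deriv has_derivative_linear by blast

lemma iter_deriv_append: "iter_deriv (us @ vs) f = iter_deriv us (iter_deriv vs f)"
  by (induction us) auto

lemma smooth_dir_deriv: "smooth f \<Longrightarrow> smooth (dir_deriv v f)"
  unfolding smooth_def
proof (intro allI)
  fix vs z
  assume "\<forall>vs z. iter_deriv vs f differentiable at z"
  then have "iter_deriv (vs @ [v]) f differentiable at z" by blast
  then show "iter_deriv vs (dir_deriv v f) differentiable at z"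
    by (simp add: iter_deriv_append)
qed

lemma smooth_iter_deriv: "smooth f \<Longrightarrow> smooth (iter_deriv vs f)"
  by (induction vs) (auto simp: smooth_dir_deriv)

lemma smooth_differentiable: "smooth f \<Longrightarrow> f differentiable (at z)"
  unfolding smooth_def by (metis iter_deriv.simps(1))

lemma smooth_continuous_on: "smooth f \<Longrightarrow> continuous_on S f"
  by (intro continuous_at_imp_continuous_on ballI differentiable_imp_continuous_within smooth_differentiable)

text \<open>
  Smooth functions form the largest class of differentiable functions that is closed under directional
  derivatives, so smoothness can be shown without any formula for iterated derivatives.
\<close>

lemma smooth_coinduct:
  assumes "C f"
    and diff: "\<And>f z. C f \<Longrightarrow> f differentiable (at z)"
    and step: "\<And>f v. C f \<Longrightarrow> C (dir_deriv v f)"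
  shows "smooth f"
proof -
  have "C (iter_deriv vs f)" for vs
    by (induction vs) (use assms in auto)
  then show ?thesis
    unfolding smooth_def using diff by blast
qed

lemma smooth_affine:
  fixes b :: "'a::euclidean_space" and c :: real
  shows "smooth (\<lambda>x. x \<bullet> b + c)"
proof -
  define C :: "('a \<Rightarrow> real) \<Rightarrow> bool" where "C f \<longleftrightarrow> (\<exists>b c. f = (\<lambda>x. x \<bullet> b + c))" for f
  have D: "((\<lambda>x. x \<bullet> b + c) has_derivative (\<lambda>v. v \<bullet> b)) (at z)" for b z :: 'a and c :: real
    by (auto intro!: derivative_eq_intros)
  show ?thesis
  proof (rule smooth_coinduct[where C = C])
    show "C (\<lambda>x. x \<bullet> b + c)" unfolding C_def by blast
    show "f differentiable at z" if "C f" for f z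
      using that D[THEN differentiableI] unfolding C_def by auto
    show "C (dir_deriv v f)" if "C f" for f v
    proof -
      obtain b c where "f = (\<lambda>x. x \<bullet> b + c)" using \<open>C f\<close> unfolding C_def by blast
      then have "dir_deriv v f = (\<lambda>x. x \<bullet> 0 + v \<bullet> b)"
        by (auto simp: dir_deriv_eqI[OF D])
      then show ?thesis unfolding C_def by blast
    qed
  qed
qed

lemma smooth_const: "smooth (\<lambda>x::'a::euclidean_space. c::real)"
  using smooth_affine[of 0 c] by simp

lemma smooth_compose_linear:
  fixes f :: "'a::euclidean_space \<Rightarrow> real" and L :: "'b::euclidean_space \<Rightarrow> 'a"
  assumes "smooth f" "bounded_linear L"
  shows "smooth (\<lambda>x. f (L x))"
proof -
  define C :: "('b \<Rightarrow> real) \<Rightarrow> bool" where "C g \<longleftrightarrow> (\<exists>f. smooth f \<and> g = (\<lambda>x. f (L x)))" for g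
  have D: "((\<lambda>x. f (L x)) has_derivative (\<lambda>v. dir_deriv (L v) f (L z))) (at z)"
    if "smooth f" for f :: "'a \<Rightarrow> real" and z
    using has_derivative_compose[OF bounded_linear_imp_has_derivative[OF assms(2)]
        has_derivative_dir_deriv[OF smooth_differentiable[OF that]]] by simp
  show ?thesis
  proof (rule smooth_coinduct[where C = C])
    show "C (\<lambda>x. f (L x))" unfolding C_def using assms(1) by blast
    show "g differentiable at z" if "C g" for g z
      using that D[THEN differentiableI] unfolding C_def by auto
    show "C (dir_deriv v g)" if "C g" for g v
    proof -
      obtain f where f: "smooth f" "g = (\<lambda>x. f (L x))" using \<open>C g\<close> unfolding C_def by blast
      then have "dir_deriv v g = (\<lambda>x. dir_deriv (L v) f (L x))"
        by (auto simp: dir_deriv_eqI[OF D])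
      then show ?thesis unfolding C_def using smooth_dir_deriv[OF f(1)] by blast
    qed
  qed
qed

lemma smooth_fst_arg: "smooth f \<Longrightarrow> smooth (\<lambda>z. f (fst z) :: real)"
  by (rule smooth_compose_linear[OF _ bounded_linear_fst])

lemma smooth_snd_arg: "smooth f \<Longrightarrow> smooth (\<lambda>z. f (snd z) :: real)"
  by (rule smooth_compose_linear[OF _ bounded_linear_snd])

text \<open>
  The directional derivative of a sum, product, inverse, exponential or logarithm of smooth functions is
  again built from smooth functions by these operations. Hence this class is closed under
  \<open>dir_deriv\<close>, and \<open>smooth_coinduct\<close> applies to it.
\<close>

inductive smooth_expr :: "('a::euclidean_space \<Rightarrow> real) \<Rightarrow> bool" where
  base: "smooth f \<Longrightarrow> smooth_expr f"
| add: "smooth_expr f \<Longrightarrow> smooth_expr g \<Longrightarrow> smooth_expr (\<lambda>x. f x + g x)"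
| mult: "smooth_expr f \<Longrightarrow> smooth_expr g \<Longrightarrow> smooth_expr (\<lambda>x. f x * g x)"
| inverse: "smooth_expr f \<Longrightarrow> (\<And>x. f x \<noteq> 0) \<Longrightarrow> smooth_expr (\<lambda>x. inverse (f x))"
| exp: "smooth_expr f \<Longrightarrow> smooth_expr (\<lambda>x. exp (f x))"
| ln: "smooth_expr f \<Longrightarrow> (\<And>x. f x > 0) \<Longrightarrow> smooth_expr (\<lambda>x. ln (f x))"

lemma smooth_expr_closed:
  "smooth_expr f \<Longrightarrow> (\<forall>z. f differentiable (at z)) \<and> (\<forall>v. smooth_expr (dir_deriv v f))"
proof (induction rule: smooth_expr.induct)
  case (base f)
  then show ?case by (simp add: smooth_differentiable smooth_dir_deriv smooth_expr.base)
next
  case (add f g)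
  then have D: "((\<lambda>x. f x + g x) has_derivative (\<lambda>v. dir_deriv v f z + dir_deriv v g z)) (at z)" for z
    by (auto intro!: derivative_eq_intros has_derivative_dir_deriv)
  have "dir_deriv v (\<lambda>x. f x + g x) = (\<lambda>x. dir_deriv v f x + dir_deriv v g x)" for v
    by (rule ext, rule dir_deriv_eqI[OF D])
  then show ?case using add D by (auto intro: differentiableI smooth_expr.add)
next
  case (mult f g)
  then have D: "((\<lambda>x. f x * g x) has_derivative (\<lambda>v. f z * dir_deriv v g z + dir_deriv v f z * g z)) (at z)" for z
    by (auto intro!: derivative_eq_intros has_derivative_dir_deriv)
  have "dir_deriv v (\<lambda>x. f x * g x) = (\<lambda>x. f x * dir_deriv v g x + dir_deriv v f x * g x)" for v
    by (rule ext, rule dir_deriv_eqI[OF D])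
  then show ?case using mult D by (auto intro!: differentiableI smooth_expr.add smooth_expr.mult)
next
  case (inverse f)
  then have D: "((\<lambda>x. inverse (f x)) has_derivative
      (\<lambda>v. (- 1) * (inverse (f z) * dir_deriv v f z * inverse (f z)))) (at z)" for z
    by (auto intro!: derivative_eq_intros has_derivative_dir_deriv)
  have eq: "dir_deriv v (\<lambda>x. inverse (f x)) = (\<lambda>x. (- 1) * (inverse (f x) * dir_deriv v f x * inverse (f x)))" for v
    by (rule ext, rule dir_deriv_eqI[OF D])
  have "smooth_expr (\<lambda>x. (- 1) * (inverse (f x) * dir_deriv v f x * inverse (f x)))" for v
    by (intro smooth_expr.inverse smooth_expr.mult smooth_expr.base[OF smooth_const]) (use inverse in auto)
  then show ?case using D[THEN differentiableI] eq by simp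
next
  case (exp f)
  then have D: "((\<lambda>x. exp (f x)) has_derivative (\<lambda>v. exp (f z) * dir_deriv v f z)) (at z)" for z
    by (auto intro!: derivative_eq_intros has_derivative_dir_deriv)
  have "dir_deriv v (\<lambda>x. exp (f x)) = (\<lambda>x. exp (f x) * dir_deriv v f x)" for v
    by (rule ext, rule dir_deriv_eqI[OF D])
  then show ?case using exp D by (auto intro!: differentiableI smooth_expr.exp smooth_expr.mult)
next
  case (ln f)
  then have D: "((\<lambda>x. ln (f x)) has_derivative (\<lambda>v. dir_deriv v f z * inverse (f z))) (at z)" for z
    by (auto intro!: derivative_eq_intros has_derivative_dir_deriv)
  have "dir_deriv v (\<lambda>x. ln (f x)) = (\<lambda>x. dir_deriv v f x * inverse (f x))" for v
    by (rule ext, rule dir_deriv_eqI[OF D])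
  moreover have "f x \<noteq> 0" for x using ln.hyps(2)[of x] by simp
  ultimately show ?case using ln D
    by (auto intro!: differentiableI smooth_expr.inverse smooth_expr.mult)
qed

lemma smooth_expr_imp_smooth: "smooth_expr f \<Longrightarrow> smooth f"
  by (rule smooth_coinduct[where C = smooth_expr]) (use smooth_expr_closed in auto)

lemma smooth_add: "smooth f \<Longrightarrow> smooth g \<Longrightarrow> smooth (\<lambda>x. f x + g x :: real)"
  by (rule smooth_expr_imp_smooth[OF smooth_expr.add[OF smooth_expr.base smooth_expr.base]])

lemma smooth_mult: "smooth f \<Longrightarrow> smooth g \<Longrightarrow> smooth (\<lambda>x. f x * g x :: real)"
  by (rule smooth_expr_imp_smooth[OF smooth_expr.mult[OF smooth_expr.base smooth_expr.base]])

lemma smooth_inverse: "smooth f \<Longrightarrow> (\<And>x. f x \<noteq> 0) \<Longrightarrow> smooth (\<lambda>x. inverse (f x) :: real)"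
  by (rule smooth_expr_imp_smooth[OF smooth_expr.inverse[OF smooth_expr.base]])

lemma smooth_exp: "smooth f \<Longrightarrow> smooth (\<lambda>x. exp (f x) :: real)"
  by (rule smooth_expr_imp_smooth[OF smooth_expr.exp[OF smooth_expr.base]])

lemma smooth_ln: "smooth f \<Longrightarrow> (\<And>x. f x > 0) \<Longrightarrow> smooth (\<lambda>x. ln (f x) :: real)"
  by (rule smooth_expr_imp_smooth[OF smooth_expr.ln[OF smooth_expr.base]])

lemma smooth_sum:
  fixes f :: "'i \<Rightarrow> 'a::euclidean_space \<Rightarrow> real"
  assumes "finite I" "\<And>i. i \<in> I \<Longrightarrow> smooth (f i)"
  shows "smooth (\<lambda>x. \<Sum>i\<in>I. f i x)"
  using assms by (induction I rule: finite_induct) (auto intro: smooth_add smooth_const)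

lemma smooth_inner_self: "smooth (\<lambda>x::'a::euclidean_space. x \<bullet> x)"
proof -
  have "smooth (\<lambda>x::'a. \<Sum>b\<in>Basis. (x \<bullet> b) * (x \<bullet> b))"
    using smooth_affine[of _ 0] by (intro smooth_sum smooth_mult) auto
  then show ?thesis by (simp add: euclidean_inner[symmetric])
qed

lemma dir_deriv_mult:
  fixes f g :: "'a::euclidean_space \<Rightarrow> real"
  assumes "smooth f" "smooth g"
  shows "dir_deriv v (\<lambda>x. f x * g x) x = f x * dir_deriv v g x + dir_deriv v f x * g x"
  by (rule dir_deriv_eqI)
     (intro has_derivative_mult has_derivative_dir_deriv smooth_differentiable assms)

lemma dir_deriv_sum:
  fixes f :: "'i \<Rightarrow> 'a::euclidean_space \<Rightarrow> real"
  assumes "\<And>i. i \<in> I \<Longrightarrow> smooth (f i)"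
  shows "dir_deriv v (\<lambda>x. \<Sum>i\<in>I. f i x) x = (\<Sum>i\<in>I. dir_deriv v (f i) x)"
  by (rule dir_deriv_eqI)
     (intro has_derivative_sum has_derivative_dir_deriv smooth_differentiable assms)

lemma iter_deriv_add_mult:
  fixes f h :: "'a::euclidean_space \<Rightarrow> real"
  assumes "smooth f" "smooth h"
  shows "iter_deriv vs (\<lambda>z. f z + t * h z) = (\<lambda>z. iter_deriv vs f z + t * iter_deriv vs h z)"
proof (induction vs)
  case (Cons v vs)
  have "((\<lambda>z. iter_deriv vs f z + t * iter_deriv vs h z) has_derivative
     (\<lambda>v. dir_deriv v (iter_deriv vs f) z + t * dir_deriv v (iter_deriv vs h) z)) (at z)" for z
    by (intro has_derivative_add has_derivative_mult_right has_derivative_dir_deriv smooth_differentiable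
        smooth_iter_deriv assms)
  then show ?case by (simp add: Cons.IH) (rule ext, rule dir_deriv_eqI)
qed simp


section \<open>Gradient, Hessian and Laplacian\<close>

definition grad :: "('a::euclidean_space \<Rightarrow> real) \<Rightarrow> 'a \<Rightarrow> 'a" where
  "grad f x = (\<Sum>b\<in>Basis. dir_deriv b f x *\<^sub>R b)"

definition hess :: "('a::euclidean_space \<Rightarrow> real) \<Rightarrow> 'a \<Rightarrow> 'a \<Rightarrow> 'a" where
  "hess f x h = (\<Sum>b\<in>Basis. dir_deriv h (dir_deriv b f) x *\<^sub>R b)"

lemma has_derivative_grad:
  assumes "smooth f" shows "(f has_derivative (\<lambda>h. grad f x \<bullet> h)) (at x)"
proof -
  have lin: "linear (\<lambda>v. dir_deriv v f x)"
    by (rule linear_dir_deriv[OF smooth_differentiable[OF assms]])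
  have "dir_deriv h f x = grad f x \<bullet> h" for h
  proof -
    have "dir_deriv h f x = dir_deriv (\<Sum>b\<in>Basis. (h \<bullet> b) *\<^sub>R b) f x"
      by (simp add: euclidean_representation)
    also have "\<dots> = (\<Sum>b\<in>Basis. (h \<bullet> b) * dir_deriv b f x)"
      by (subst linear_sum[OF lin]) (simp add: linear_cmul[OF lin])
    also have "\<dots> = grad f x \<bullet> h"
      unfolding grad_def inner_sum_left by (intro sum.cong) (simp_all add: inner_commute)
    finally show ?thesis .
  qed
  then show ?thesis
    using has_derivative_dir_deriv[OF smooth_differentiable[OF assms], of x] by (simp only:)
qed

lemma has_derivative_hess:
  assumes "smooth f" shows "(grad f has_derivative hess f x) (at x)"
  unfolding grad_def hess_def
  by (auto intro!: derivative_eq_intros has_derivative_dir_deriv smooth_differentiable smooth_dir_deriv assms)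

lemma grad_inner_Basis: "b \<in> Basis \<Longrightarrow> grad f x \<bullet> b = dir_deriv b f x"
  by (simp add: grad_def inner_sum_left_Basis)

lemma hess_inner_Basis: "b \<in> Basis \<Longrightarrow> hess f x h \<bullet> b = dir_deriv h (dir_deriv b f) x"
  by (simp add: hess_def inner_sum_left_Basis)

lemma smooth_continuous_on_grad: "smooth f \<Longrightarrow> continuous_on S (grad f)"
  by (intro continuous_at_imp_continuous_on ballI has_derivative_continuous[OF has_derivative_hess])

lemma norm_grad_le:
  fixes f :: "'a::euclidean_space \<Rightarrow> real"
  assumes "\<And>b. b \<in> Basis \<Longrightarrow> \<bar>dir_deriv b f x\<bar> \<le> c"
  shows "norm (grad f x) \<le> real DIM('a) * c"
proof -
  have "norm (grad f x) \<le> (\<Sum>b\<in>(Basis::'a set). c)"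
    unfolding grad_def by (rule sum_norm_le) (use assms in auto)
  then show ?thesis by simp
qed

lemma norm_hess_le:
  fixes f :: "'a::euclidean_space \<Rightarrow> real"
  assumes "smooth f"
    and "\<And>b b'. b \<in> Basis \<Longrightarrow> b' \<in> Basis \<Longrightarrow> \<bar>dir_deriv b (dir_deriv b' f) x\<bar> \<le> c"
  shows "norm (hess f x h) \<le> (real DIM('a))\<^sup>2 * c * norm h"
proof -
  have b: "\<bar>dir_deriv h (dir_deriv b' f) x\<bar> \<le> real DIM('a) * c * norm h" if b': "b' \<in> Basis" for b'
  proof -
    have "dir_deriv h (dir_deriv b' f) x = grad (dir_deriv b' f) x \<bullet> h"
      by (rule dir_deriv_eqI[OF has_derivative_grad[OF smooth_dir_deriv[OF assms(1)]]])
    also have "\<bar>\<dots>\<bar> \<le> norm (grad (dir_deriv b' f) x) * norm h"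
      by (rule Cauchy_Schwarz_ineq2)
    also have "\<dots> \<le> (real DIM('a) * c) * norm h"
      by (intro mult_right_mono norm_grad_le) (use assms(2) b' in auto)
    finally show ?thesis .
  qed
  have "norm (hess f x h) \<le> (\<Sum>b\<in>(Basis::'a set). real DIM('a) * c * norm h)"
    unfolding hess_def by (rule sum_norm_le) (use b in auto)
  then show ?thesis by (simp add: power2_eq_square mult.assoc)
qed

definition laplacian :: "('a::euclidean_space \<Rightarrow> real) \<Rightarrow> 'a \<Rightarrow> real" where
  "laplacian f x = (\<Sum>b\<in>Basis. dir_deriv b (dir_deriv b f) x)"

lemma trace_hess: "(\<Sum>b\<in>Basis. hess f x b \<bullet> b) = laplacian f x"
  unfolding laplacian_def by (intro sum.cong refl hess_inner_Basis)

lemma smooth_laplacian: "smooth f \<Longrightarrow> smooth (laplacian f)"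
  unfolding laplacian_def[abs_def] by (intro smooth_sum smooth_dir_deriv) auto

definition grad_sq :: "('a::euclidean_space \<Rightarrow> real) \<Rightarrow> 'a \<Rightarrow> real" where
  "grad_sq f x = (\<Sum>b\<in>Basis. dir_deriv b f x * dir_deriv b f x)"

lemma smooth_grad_sq: "smooth f \<Longrightarrow> smooth (grad_sq f)"
  unfolding grad_sq_def[abs_def] by (intro smooth_sum smooth_mult smooth_dir_deriv) auto

text \<open>
  Third derivatives of \<open>f\<close> occur only multiplied by first derivatives, which vanish at a critical point.
\<close>

lemma laplacian_grad_sq_critical:
  assumes f: "smooth f" and crit: "\<And>b. b \<in> Basis \<Longrightarrow> dir_deriv b f x = 0"
  shows "laplacian (grad_sq f) x = 2 * (\<Sum>a\<in>Basis. \<Sum>b\<in>Basis. (dir_deriv a (dir_deriv b f) x)\<^sup>2)"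
proof -
  have "dir_deriv a (dir_deriv a (grad_sq f)) x = 2 * (\<Sum>b\<in>Basis. (dir_deriv a (dir_deriv b f) x)\<^sup>2)" for a
  proof -
    have D: "smooth (dir_deriv b f)" "smooth (dir_deriv a (dir_deriv b f))" for b
      by (intro smooth_dir_deriv f)+
    have "dir_deriv a (grad_sq f) = (\<lambda>y. \<Sum>b\<in>Basis. 2 * (dir_deriv b f y * dir_deriv a (dir_deriv b f) y))"
      unfolding grad_sq_def[abs_def]
      by (rule ext, subst dir_deriv_sum) (auto intro!: smooth_mult D sum.cong simp: dir_deriv_mult D)
    then have "dir_deriv a (dir_deriv a (grad_sq f)) x
        = dir_deriv a (\<lambda>y. \<Sum>b\<in>Basis. 2 * (dir_deriv b f y * dir_deriv a (dir_deriv b f) y)) x" by simp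
    also have "\<dots> = (\<Sum>b\<in>Basis. dir_deriv a (\<lambda>y. 2 * (dir_deriv b f y * dir_deriv a (dir_deriv b f) y)) x)"
      by (rule dir_deriv_sum) (intro smooth_mult smooth_const D)
    also have "\<dots> = (\<Sum>b\<in>Basis. 2 * (dir_deriv a (dir_deriv b f) x)\<^sup>2)"
    proof (rule sum.cong[OF refl])
      fix b :: 'a assume b: "b \<in> Basis"
      have c2: "dir_deriv a (\<lambda>_::'a. 2 :: real) x = 0"
        by (rule dir_deriv_eqI) simp
      show "dir_deriv a (\<lambda>y. 2 * (dir_deriv b f y * dir_deriv a (dir_deriv b f) y)) x
          = 2 * (dir_deriv a (dir_deriv b f) x)\<^sup>2"
        using crit[OF b]
        by (subst dir_deriv_mult) (auto intro!: smooth_const smooth_mult D simp: c2 dir_deriv_mult D power2_eq_square)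
    qed
    finally show ?thesis by (simp add: sum_distrib_left)
  qed
  then show ?thesis unfolding laplacian_def by (simp add: sum_distrib_left)
qed

lemma grad_ln_eq_0:
  assumes "smooth f" "\<And>x. f x > 0" "grad (\<lambda>x. ln (f x)) x = 0"
  shows "grad f x = 0"
proof -
  have "((\<lambda>x. ln (f x)) has_derivative (\<lambda>v. dir_deriv v f x * inverse (f x))) (at x)"
    using assms(2)[of x] by (auto intro!: derivative_eq_intros has_derivative_dir_deriv smooth_differentiable assms(1))
  then have "dir_deriv v (\<lambda>x. ln (f x)) x = dir_deriv v f x * inverse (f x)" for v
    by (rule dir_deriv_eqI)
  then have "dir_deriv b f x = 0" if "b \<in> Basis" for b
    using grad_inner_Basis[OF that, of "\<lambda>x. ln (f x)" x] assms(2)[of x] unfolding assms(3) by simp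
  then show ?thesis unfolding grad_def by simp
qed


section \<open>Periodic functions\<close>

definition lattice_periodic :: "(real ^ 'm::finite \<Rightarrow> 'b) \<Rightarrow> bool" where
  "lattice_periodic f \<longleftrightarrow> (\<forall>x y. lattice_rel x y \<longrightarrow> f x = f y)"

lemma lattice_periodic_in_coords: "lattice_periodic (in_coords F)"
  unfolding lattice_periodic_def in_coords_def using torus.abs_eq_iff by metis

text \<open>
  Functions on the torus are the same as periodic functions; the choice of representatives is
  immaterial.
\<close>

lemma in_coords_rep:
  fixes f :: "real ^ 'm::finite \<Rightarrow> real"
  assumes "lattice_periodic f" shows "in_coords (\<lambda>q. f (rep_torus q)) = f"
proof
  fix x :: "real ^ 'm"
  have "torus_proj (rep_torus (torus_proj x)) = torus_proj x"
    by (rule Quotient3_abs_rep[OF Quotient3_torus])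
  then have "lattice_rel (rep_torus (torus_proj x)) x"
    by (simp add: torus.abs_eq_iff)
  then show "in_coords (\<lambda>q. f (rep_torus q)) x = f x"
    using assms unfolding lattice_periodic_def in_coords_def by blast
qed

lemma lattice_periodic_dir_deriv:
  assumes "smooth f" "lattice_periodic f"
  shows "lattice_periodic (dir_deriv v f)"
  unfolding lattice_periodic_def
proof (intro allI impI)
  fix x y :: "real^'a" assume xy: "lattice_rel x y"
  have f: "(\<lambda>z. f (z + (x - y))) = f"
  proof
    fix z
    have "lattice_rel (z + (x - y)) z" using xy by (simp add: lattice_rel_def)
    then show "f (z + (x - y)) = f z" using assms(2) unfolding lattice_periodic_def by blast
  qed
  have "((\<lambda>z. f (z + (x - y))) has_derivative (\<lambda>v. dir_deriv v f (y + (x - y)))) (at y)"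
    by (rule has_derivative_compose[OF _ has_derivative_dir_deriv[OF smooth_differentiable[OF assms(1)]]])
       (auto intro!: derivative_eq_intros)
  then have "(f has_derivative (\<lambda>v. dir_deriv v f x)) (at y)" unfolding f by simp
  then show "dir_deriv v f x = dir_deriv v f y" using dir_deriv_eqI by metis
qed

lemma lattice_periodic_iter_deriv:
  "smooth f \<Longrightarrow> lattice_periodic f \<Longrightarrow> lattice_periodic (iter_deriv vs f)"
  by (induction vs) (auto intro: lattice_periodic_dir_deriv smooth_iter_deriv)

lemma lattice_periodic_grad:
  "smooth f \<Longrightarrow> lattice_periodic f \<Longrightarrow> lattice_periodic (grad f)"
  using lattice_periodic_dir_deriv[of f] unfolding lattice_periodic_def grad_def
  by (intro allI impI sum.cong) auto

lemma lattice_periodic_laplacian: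
  "smooth f \<Longrightarrow> lattice_periodic f \<Longrightarrow> lattice_periodic (laplacian f)"
  using lattice_periodic_dir_deriv[OF smooth_dir_deriv lattice_periodic_dir_deriv]
  unfolding lattice_periodic_def laplacian_def by (intro allI impI sum.cong) blast+

lemma lattice_periodic_grad_sq:
  assumes "smooth f" "lattice_periodic f" shows "lattice_periodic (grad_sq f)"
  unfolding lattice_periodic_def grad_sq_def
proof (intro allI impI)
  fix x y :: "real ^ 'a" assume "lattice_rel x y"
  then have "dir_deriv b f x = dir_deriv b f y" for b
    using lattice_periodic_dir_deriv[OF assms] unfolding lattice_periodic_def by blast
  then show "(\<Sum>b\<in>Basis. dir_deriv b f x * dir_deriv b f x) = (\<Sum>b\<in>Basis. dir_deriv b f y * dir_deriv b f y)"
    by simp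
qed

lemma lattice_rel_cube:
  fixes x :: "real ^ 'm::finite"
  obtains y where "y \<in> cbox 0 (\<chi> i. 1)" "lattice_rel x y"
proof
  show "(\<chi> i. frac (x $ i)) \<in> cbox 0 (\<chi> i. 1)"
    by (simp add: mem_box_cart less_imp_le[OF frac_lt_1])
  show "lattice_rel x (\<chi> i. frac (x $ i))"
    by (simp add: lattice_rel_def frac_def)
qed

lemma lattice_periodic_bounded:
  fixes f :: "real ^ 'm::finite \<Rightarrow> real"
  assumes "smooth f" "lattice_periodic f"
  shows "\<exists>C. \<forall>x. \<bar>f x\<bar> \<le> C"
proof -
  have "bounded (f ` cbox 0 (\<chi> i. 1))"
    by (intro compact_imp_bounded compact_continuous_image smooth_continuous_on assms) simp
  then obtain C where C: "\<And>y. y \<in> cbox 0 (\<chi> i. 1) \<Longrightarrow> \<bar>f y\<bar> \<le> C"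
    unfolding bounded_iff by auto
  have "\<bar>f x\<bar> \<le> C" for x
    using assms(2) C lattice_rel_cube[of x] unfolding lattice_periodic_def by metis
  then show ?thesis by blast
qed

lemma lattice_periodic_bounded_finite:
  fixes f :: "'i \<Rightarrow> real ^ 'm::finite \<Rightarrow> real"
  assumes "finite I" "\<And>i. i \<in> I \<Longrightarrow> smooth (f i)" "\<And>i. i \<in> I \<Longrightarrow> lattice_periodic (f i)"
  shows "\<exists>C. \<forall>i\<in>I. \<forall>x. \<bar>f i x\<bar> \<le> C"
proof -
  have "\<forall>i\<in>I. \<exists>C. \<forall>x. \<bar>f i x\<bar> \<le> C"
    using lattice_periodic_bounded assms(2,3) by blast
  then obtain C where "\<forall>i\<in>I. \<forall>x. \<bar>f i x\<bar> \<le> C i"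
    unfolding bchoice_iff by blast
  then have C: "\<bar>f i x\<bar> \<le> C i" if "i \<in> I" for i x
    using that by blast
  have "\<bar>f i x\<bar> \<le> (\<Sum>j\<in>I. C j)" if "i \<in> I" for i x
  proof -
    have "C i \<le> (\<Sum>j\<in>I. C j)"
      by (rule member_le_sum) (use that assms(1) C in \<open>auto intro: order_trans[OF abs_ge_zero]\<close>)
    then show ?thesis using C[OF that] by (rule order_trans[rotated])
  qed
  then show ?thesis by blast
qed

lemma finite_iter_deriv_lists: "finite {vs :: 'a::euclidean_space list. set vs \<subseteq> Basis \<and> length vs \<le> N}"
  by (rule finite_lists_length_le) simp

text \<open>
  The supremum in the definition of the norm is finite because periodic smooth functions are bounded.
\<close>

lemma iter_deriv_le_C2_norm:
  assumes F: "smooth_torus F" and vs: "set vs \<subseteq> Basis" "length vs \<le> 2"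
  shows "\<bar>iter_deriv vs (in_coords F) x\<bar> \<le> C2_norm F"
proof -
  have sm: "smooth (in_coords F)" using F by (simp add: smooth_torus_def)
  obtain C where "\<forall>vs\<in>{vs. set vs \<subseteq> Basis \<and> length vs \<le> 2}. \<forall>x. \<bar>iter_deriv vs (in_coords F) x\<bar> \<le> C"
    using lattice_periodic_bounded_finite[OF finite_iter_deriv_lists, of 2 "\<lambda>vs. iter_deriv vs (in_coords F)"]
      smooth_iter_deriv[OF sm] lattice_periodic_iter_deriv[OF sm lattice_periodic_in_coords] by blast
  then show ?thesis
    unfolding C2_norm_def using vs by (intro cSup_upper bdd_aboveI[of _ C]) auto
qed

text \<open>
  The Morse condition prevents the Hessian from vanishing at a critical point. So the squared gradient is a
  smooth function on the whole torus with positive Laplacian at all critical points.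
\<close>

lemma laplacian_grad_sq_pos:
  fixes F :: "'m::finite torus \<Rightarrow> real"
  assumes F: "morse_torus F" and crit: "grad (in_coords F) x = 0"
  shows "laplacian (grad_sq (in_coords F)) x > 0"
proof -
  let ?f = "in_coords F"
  have sm: "smooth ?f" using F by (simp add: morse_torus_def smooth_torus_def)
  have d0: "dir_deriv b ?f x = 0" if "b \<in> Basis" for b
    using grad_inner_Basis[OF that, of ?f x] crit by simp
  have ax: "axis i 1 \<in> (Basis :: (real^'m) set)" for i by (simp add: axis_in_Basis_iff)
  have "\<forall>i. iter_deriv [axis i 1] ?f x = 0" using d0[OF ax] by simp
  then have "det (\<chi> i j. iter_deriv [axis i 1, axis j 1] ?f x) \<noteq> 0"
    using F unfolding morse_torus_def by blast
  then have "(\<chi> i j. iter_deriv [axis i 1, axis j 1] ?f x) \<noteq> 0"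
    using det_0 by (metis mat_0)
  then obtain i j where ij: "dir_deriv (axis i 1) (dir_deriv (axis j 1) ?f) x \<noteq> 0"
    by (auto simp: vec_eq_iff)
  have "0 < (\<Sum>b\<in>Basis. (dir_deriv (axis i 1) (dir_deriv b ?f) x)\<^sup>2)"
    by (rule sum_pos2[OF _ ax[of j]]) (use ij in auto)
  then have "0 < (\<Sum>a\<in>Basis. \<Sum>b\<in>Basis. (dir_deriv a (dir_deriv b ?f) x)\<^sup>2)"
    by (rule sum_pos2[OF finite_Basis ax[of i]]) (simp add: sum_nonneg)
  then show ?thesis using laplacian_grad_sq_critical[OF sm d0] by simp
qed


section \<open>Curvature of a doubly warped metric\<close>

text \<open>
  The value at \<open>(a, b, b, a)\<close> of the Kulkarni--Nomizu product of \<open>B\<close> with the inner product.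
\<close>

definition kulkarni_nomizu :: "('a::real_inner \<Rightarrow> 'a \<Rightarrow> real) \<Rightarrow> 'a \<Rightarrow> 'a \<Rightarrow> real" where
  "kulkarni_nomizu B a b = B a a * (b \<bullet> b) + B b b * (a \<bullet> a) - 2 * B a b * (a \<bullet> b)"

text \<open>
  For \<open>g\<close> and \<open>H\<close> the gradient and Hessian of \<open>u\<close>, this is the Schouten tensor (in dimension at least
  three) of the conformally flat metric \<open>exp (2 * u) * dx\<^sup>2\<close>; the curvature of that metric is \<open>exp (2 * u)\<close> times its Kulkarni--Nomizu
  product with the Euclidean metric.
\<close>

definition conformal_form :: "'a::real_inner \<Rightarrow> ('a \<Rightarrow> 'a) \<Rightarrow> 'a \<Rightarrow> 'a \<Rightarrow> real" where
  "conformal_form g H a b = - (H a \<bullet> b) + (g \<bullet> a) * (g \<bullet> b) - (g \<bullet> g) / 2 * (a \<bullet> b)"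

text \<open>
  For \<open>g\<close> and \<open>H\<close> the gradient and Hessian of \<open>\<phi>\<close> and \<open>q\<close> the gradient of \<open>\<psi>\<close>, this is
  \<open>- Hess (exp \<phi>) / exp \<phi>\<close>, with the Hessian taken in the metric \<open>exp (2 * \<psi>) * dx\<^sup>2\<close>. It gives the
  curvature of planes spanned by a fibre direction and a base direction.
\<close>

definition mixed_form :: "'a::real_inner \<Rightarrow> ('a \<Rightarrow> 'a) \<Rightarrow> 'a \<Rightarrow> 'a \<Rightarrow> 'a \<Rightarrow> real" where
  "mixed_form g H q a b = - (H a \<bullet> b) - (g \<bullet> a) * (g \<bullet> b) + (q \<bullet> a) * (g \<bullet> b) + (q \<bullet> b) * (g \<bullet> a)
     - (q \<bullet> g) * (a \<bullet> b)"

text \<open>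
  The Levi-Civita connection of \<open>exp (2 * (\<sigma> + \<phi>)) * dy\<^sup>2 + exp (2 * \<psi>) * dx\<^sup>2\<close> on constant fields, in
  terms of the gradients \<open>s\<close>, \<open>f\<close>, \<open>p\<close> of \<open>\<sigma>(y)\<close>, \<open>\<phi>(x)\<close>, \<open>\<psi>(x)\<close> and the quotient \<open>r\<close> of the two factors.
\<close>

definition warped_conn ::
    "real \<Rightarrow> 'v::real_inner \<Rightarrow> 'x::real_inner \<Rightarrow> 'x \<Rightarrow> 'v \<times> 'x \<Rightarrow> 'v \<times> 'x \<Rightarrow> 'v \<times> 'x" where
  "warped_conn r s f p a b =
    ((s \<bullet> fst a + f \<bullet> snd a) *\<^sub>R fst b + (s \<bullet> fst b + f \<bullet> snd b) *\<^sub>R fst a - (fst a \<bullet> fst b) *\<^sub>R s,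
     (p \<bullet> snd a) *\<^sub>R snd b + (p \<bullet> snd b) *\<^sub>R snd a - (snd a \<bullet> snd b) *\<^sub>R p
      - (r * (fst a \<bullet> fst b)) *\<^sub>R f)"

text \<open>
  The product rule applied to \<open>warped_conn\<close>, with \<open>dr\<close>, \<open>ds\<close>, \<open>df\<close>, \<open>dp\<close> the derivatives of its arguments.
\<close>

definition warped_conn_deriv ::
    "real \<Rightarrow> 'x::real_inner \<Rightarrow> real \<Rightarrow> 'v::real_inner \<Rightarrow> 'x \<Rightarrow> 'x \<Rightarrow> 'v \<times> 'x \<Rightarrow> 'v \<times> 'x \<Rightarrow> 'v \<times> 'x" where
  "warped_conn_deriv r f dr ds df dp a b =
    ((ds \<bullet> fst a + df \<bullet> snd a) *\<^sub>R fst b + (ds \<bullet> fst b + df \<bullet> snd b) *\<^sub>R fst a - (fst a \<bullet> fst b) *\<^sub>R ds,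
     (dp \<bullet> snd a) *\<^sub>R snd b + (dp \<bullet> snd b) *\<^sub>R snd a - (snd a \<bullet> snd b) *\<^sub>R dp
      - (dr * (fst a \<bullet> fst b)) *\<^sub>R f - (r * (fst a \<bullet> fst b)) *\<^sub>R df)"

text \<open>
  The curvature identity at one point, once derivatives are replaced by their values. It is an identity
  between polynomials in the inner products, and \<open>r * fst + snd\<close> is the metric divided by the second
  factor.
\<close>

lemma warped_conn_curvature:
  fixes s :: "'v::real_inner" and f p :: "'x::real_inner" and r :: real
    and S :: "'v \<Rightarrow> 'v" and F H :: "'x \<Rightarrow> 'x" and a b :: "'v \<times> 'x"
  defines "\<Gamma> \<equiv> warped_conn r s f p"
    and "D \<equiv> \<lambda>c. warped_conn_deriv r f (2 * r * (s \<bullet> fst c + f \<bullet> snd c - p \<bullet> snd c))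
              (S (fst c)) (F (snd c)) (H (snd c))"
  defines "R \<equiv> D a b b - D b a b + \<Gamma> a (\<Gamma> b b) - \<Gamma> b (\<Gamma> a b)"
  shows "r * (fst R \<bullet> fst a) + snd R \<bullet> snd a =
     r * kulkarni_nomizu (conformal_form s S) (fst a) (fst b)
     - r * r * (f \<bullet> f) * ((fst a \<bullet> fst a) * (fst b \<bullet> fst b) - (fst a \<bullet> fst b) * (fst a \<bullet> fst b))
     + r * ((fst a \<bullet> fst a) * mixed_form f F p (snd b) (snd b)
          + (fst b \<bullet> fst b) * mixed_form f F p (snd a) (snd a)
          - 2 * (fst a \<bullet> fst b) * mixed_form f F p (snd a) (snd b))
     + kulkarni_nomizu (conformal_form p H) (snd a) (snd b)"
  unfolding R_def D_def \<Gamma>_def warped_conn_def warped_conn_deriv_def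
    kulkarni_nomizu_def conformal_form_def mixed_form_def
  by (simp only: inner_add_left inner_diff_left inner_add_right inner_diff_right inner_scaleR_left
      inner_scaleR_right fst_conv snd_conv fst_add snd_add fst_diff snd_diff,
    simp only: inner_commute[of "fst b" "fst a"] inner_commute[of "snd b" "snd a"]
      inner_commute[of "fst a" s] inner_commute[of "fst b" s] inner_commute[of "snd a" f]
      inner_commute[of "snd b" f] inner_commute[of "snd b" p] inner_commute[of "snd a" p] inner_commute[of p f],
    simp add: field_simps)

lemma has_derivative_warped_conn:
  assumes r: "(r has_derivative r') (at z)" and s: "(s has_derivative s') (at z)"
    and f: "(f has_derivative f') (at z)" and p: "(p has_derivative p') (at z)"
  shows "((\<lambda>z. warped_conn (r z) (s z) (f z) (p z) a b) has_derivative
    (\<lambda>c. warped_conn_deriv (r z) (f z) (r' c) (s' c) (f' c) (p' c) a b)) (at z)"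
proof -
  have scal: "((\<lambda>z. u z \<bullet> v) has_derivative (\<lambda>c. u' c \<bullet> v)) (at z)"
    if "(u has_derivative u') (at z)" for u u' and v :: "'d::real_inner"
    by (rule has_derivative_inner_left[OF that])
  note d = has_derivative_add has_derivative_diff has_derivative_scaleR_left has_derivative_scaleR_right
    scal r s f p
  have 1: "((\<lambda>z. (s z \<bullet> fst a + f z \<bullet> snd a) *\<^sub>R fst b + (s z \<bullet> fst b + f z \<bullet> snd b) *\<^sub>R fst a
         - (fst a \<bullet> fst b) *\<^sub>R s z) has_derivative
      (\<lambda>c. (s' c \<bullet> fst a + f' c \<bullet> snd a) *\<^sub>R fst b + (s' c \<bullet> fst b + f' c \<bullet> snd b) *\<^sub>R fst a
         - (fst a \<bullet> fst b) *\<^sub>R s' c)) (at z)"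
    by (intro d)
  have 2: "((\<lambda>z. (p z \<bullet> snd a) *\<^sub>R snd b + (p z \<bullet> snd b) *\<^sub>R snd a - (snd a \<bullet> snd b) *\<^sub>R p z)
      has_derivative
      (\<lambda>c. (p' c \<bullet> snd a) *\<^sub>R snd b + (p' c \<bullet> snd b) *\<^sub>R snd a - (snd a \<bullet> snd b) *\<^sub>R p' c)) (at z)"
    by (intro d)
  have 3: "((\<lambda>z. (r z * (fst a \<bullet> fst b)) *\<^sub>R f z) has_derivative
      (\<lambda>c. (r z * (fst a \<bullet> fst b)) *\<^sub>R f' c + (r' c * (fst a \<bullet> fst b)) *\<^sub>R f z)) (at z)"
    by (intro has_derivative_scaleR has_derivative_mult_left r f)
  show ?thesis
    unfolding warped_conn_def warped_conn_deriv_def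
    by (rule has_derivative_eq_rhs[OF has_derivative_Pair[OF 1 has_derivative_diff[OF 2 3]]])
       (simp add: algebra_simps)
qed

lemma has_derivative_fst_arg:
  "(f has_derivative f') (at (fst z)) \<Longrightarrow> ((\<lambda>w. f (fst w)) has_derivative (\<lambda>h. f' (fst h))) (at z)"
  using has_derivative_compose[OF has_derivative_fst[OF has_derivative_ident]] by blast

lemma has_derivative_snd_arg:
  "(f has_derivative f') (at (snd z)) \<Longrightarrow> ((\<lambda>w. f (snd w)) has_derivative (\<lambda>h. f' (snd h))) (at z)"
  using has_derivative_compose[OF has_derivative_snd[OF has_derivative_ident]] by blast

text \<open>
  The metric \<open>exp (2 * (\<sigma> + \<phi>)) * dy\<^sup>2 + exp (2 * \<psi>) * dx\<^sup>2\<close>, where \<open>\<sigma>\<close> depends on \<open>y\<close> and \<open>\<phi>\<close>, \<open>\<psi>\<close> depend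
  on \<open>x\<close>. In a stereographic chart the factor \<open>exp (2 * \<sigma>)\<close> makes the first summand a round metric. The
  gradients \<open>g\<close> and Hessians \<open>H\<close> are part of the data, so that the curvature is an explicit
  expression in them.
\<close>

locale doubly_warped =
  fixes \<sigma> :: "'v::euclidean_space \<Rightarrow> real" and \<phi> \<psi> :: "'x::euclidean_space \<Rightarrow> real"
    and g\<sigma> H\<sigma> g\<phi> H\<phi> g\<psi> H\<psi>
  assumes d\<sigma>: "\<And>y. (\<sigma> has_derivative (\<lambda>h. g\<sigma> y \<bullet> h)) (at y)"
    and d\<phi>: "\<And>x. (\<phi> has_derivative (\<lambda>h. g\<phi> x \<bullet> h)) (at x)"
    and d\<psi>: "\<And>x. (\<psi> has_derivative (\<lambda>h. g\<psi> x \<bullet> h)) (at x)"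
    and dd\<sigma>: "\<And>y. (g\<sigma> has_derivative H\<sigma> y) (at y)"
    and dd\<phi>: "\<And>x. (g\<phi> has_derivative H\<phi> x) (at x)"
    and dd\<psi>: "\<And>x. (g\<psi> has_derivative H\<psi> x) (at x)"

begin

definition P :: "'v \<times> 'x \<Rightarrow> real" where "P z = exp (2 * (\<sigma> (fst z) + \<phi> (snd z)))"

definition Q :: "'v \<times> 'x \<Rightarrow> real" where "Q z = exp (2 * \<psi> (snd z))"

definition G :: "'v \<times> 'x \<Rightarrow> 'v \<times> 'x \<Rightarrow> 'v \<times> 'x \<Rightarrow> real" where
  "G z a b = P z * (fst a \<bullet> fst b) + Q z * (snd a \<bullet> snd b)"

definition chr :: "'v \<times> 'x \<Rightarrow> 'v \<times> 'x \<Rightarrow> 'v \<times> 'x \<Rightarrow> 'v \<times> 'x" where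
  "chr z = warped_conn (P z / Q z) (g\<sigma> (fst z)) (g\<phi> (snd z)) (g\<psi> (snd z))"

lemma PQ_pos: "P z > 0" "Q z > 0" by (simp_all add: P_def Q_def)

lemmas chain = has_derivative_fst_arg[OF d\<sigma>] has_derivative_snd_arg[OF d\<phi>] has_derivative_snd_arg[OF d\<psi>]
  has_derivative_fst_arg[OF dd\<sigma>] has_derivative_snd_arg[OF dd\<phi>] has_derivative_snd_arg[OF dd\<psi>]

lemma has_derivative_P:
  "(P has_derivative (\<lambda>h. 2 * P z * (g\<sigma> (fst z) \<bullet> fst h + g\<phi> (snd z) \<bullet> snd h))) (at z)"
  unfolding P_def[abs_def] by (auto intro!: derivative_eq_intros chain simp: algebra_simps)

lemma has_derivative_Q: "(Q has_derivative (\<lambda>h. 2 * Q z * (g\<psi> (snd z) \<bullet> snd h))) (at z)"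
  unfolding Q_def[abs_def] by (auto intro!: derivative_eq_intros chain)

lemma has_derivative_PQ:
  "((\<lambda>z. P z / Q z) has_derivative
     (\<lambda>h. 2 * (P z / Q z) * (g\<sigma> (fst z) \<bullet> fst h + g\<phi> (snd z) \<bullet> snd h - g\<psi> (snd z) \<bullet> snd h))) (at z)"
proof -
  have PQ: "P z / Q z = exp (2 * (\<sigma> (fst z) + \<phi> (snd z) - \<psi> (snd z)))" for z
    by (simp add: P_def Q_def exp_diff[symmetric] algebra_simps)
  show ?thesis
    unfolding PQ by (auto intro!: derivative_eq_intros chain simp: algebra_simps)
qed

lemma dir_deriv_G:
  "dir_deriv c (\<lambda>y. G y a b) z = 2 * P z * (g\<sigma> (fst z) \<bullet> fst c + g\<phi> (snd z) \<bullet> snd c) * (fst a \<bullet> fst b)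
     + 2 * Q z * (g\<psi> (snd z) \<bullet> snd c) * (snd a \<bullet> snd b)"
  unfolding G_def
  by (rule dir_deriv_eqI) (auto intro!: derivative_eq_intros has_derivative_P has_derivative_Q)

text \<open>
  The connection coefficients satisfy the Koszul formula by construction; the metric is nondegenerate, so
  no other vector does.
\<close>

lemma christoffel_G: "christoffel G z a b = chr z a b"
  unfolding christoffel_def
proof (rule the_equality)
  have *: "2 * G z (chr z a b) c =
      dir_deriv a (\<lambda>y. G y b c) z + dir_deriv b (\<lambda>y. G y a c) z - dir_deriv c (\<lambda>y. G y a b) z" for c
    unfolding dir_deriv_G unfolding G_def chr_def warped_conn_def
    using PQ_pos[of z]
    by (simp add: inner_add_left inner_diff_left field_simps)
  then show "\<forall>c. 2 * G z (chr z a b) c =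
      dir_deriv a (\<lambda>y. G y b c) z + dir_deriv b (\<lambda>y. G y a c) z - dir_deriv c (\<lambda>y. G y a b) z" by blast
  fix w assume w: "\<forall>c. 2 * G z w c =
      dir_deriv a (\<lambda>y. G y b c) z + dir_deriv b (\<lambda>y. G y a c) z - dir_deriv c (\<lambda>y. G y a b) z"
  define u where "u = w - chr z a b"
  have "G z w u = G z (chr z a b) u" using w * by (metis mult_cancel_left zero_neq_numeral)
  then have "P z * (fst u \<bullet> fst u) + Q z * (snd u \<bullet> snd u) = 0"
    unfolding G_def u_def by (simp add: inner_diff_left algebra_simps)
  then have "fst u \<bullet> fst u = 0" "snd u \<bullet> snd u = 0"
    using PQ_pos[of z] by (smt (verit) inner_ge_zero mult_nonneg_nonneg mult_pos_pos)+
  then show "w = chr z a b" unfolding u_def by (simp add: prod_eq_iff)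
qed

definition dchr :: "'v \<times> 'x \<Rightarrow> 'v \<times> 'x \<Rightarrow> 'v \<times> 'x \<Rightarrow> 'v \<times> 'x \<Rightarrow> 'v \<times> 'x" where
  "dchr z c = warped_conn_deriv (P z / Q z) (g\<phi> (snd z))
     (2 * (P z / Q z) * (g\<sigma> (fst z) \<bullet> fst c + g\<phi> (snd z) \<bullet> snd c - g\<psi> (snd z) \<bullet> snd c))
     (H\<sigma> (fst z) (fst c)) (H\<phi> (snd z) (snd c)) (H\<psi> (snd z) (snd c))"

lemma dir_deriv_chr: "dir_deriv c (\<lambda>y. chr y a b) z = dchr z c a b"
  unfolding chr_def dchr_def
  by (rule dir_deriv_eqI) (intro has_derivative_warped_conn has_derivative_PQ chain)

text \<open>
  The fibre components, the mixed components and the base components of the plane contribute separately: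
  the fibre by its own curvature, lowered by the gradient of the warping function, the other two by
  \<open>mixed_form\<close> and \<open>conformal_form\<close>. Since there are no cross terms, tilting a frame away from the base
  changes its curvature sum only to second order in the tilt.
\<close>

lemma riemann_G:
  "riemann G z a b b a =
     P z * kulkarni_nomizu (conformal_form (g\<sigma> (fst z)) (H\<sigma> (fst z))) (fst a) (fst b)
     - (P z)\<^sup>2 / Q z * (g\<phi> (snd z) \<bullet> g\<phi> (snd z))
         * ((fst a \<bullet> fst a) * (fst b \<bullet> fst b) - (fst a \<bullet> fst b)\<^sup>2)
     + P z * ((fst a \<bullet> fst a) * mixed_form (g\<phi> (snd z)) (H\<phi> (snd z)) (g\<psi> (snd z)) (snd b) (snd b)
            + (fst b \<bullet> fst b) * mixed_form (g\<phi> (snd z)) (H\<phi> (snd z)) (g\<psi> (snd z)) (snd a) (snd a)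
            - 2 * (fst a \<bullet> fst b) * mixed_form (g\<phi> (snd z)) (H\<phi> (snd z)) (g\<psi> (snd z)) (snd a) (snd b))
     + Q z * kulkarni_nomizu (conformal_form (g\<psi> (snd z)) (H\<psi> (snd z))) (snd a) (snd b)"
proof -
  let ?r = "P z / Q z"
  define R where "R = dchr z a b b - dchr z b a b + chr z a (chr z b b) - chr z b (chr z a b)"
  have "riemann G z a b b a = G z R a"
    unfolding riemann_def riemann_endo_def christoffel_G dir_deriv_chr R_def ..
  also have "\<dots> = Q z * (?r * (fst R \<bullet> fst a) + snd R \<bullet> snd a)"
    unfolding G_def using PQ_pos[of z] by (simp add: field_simps)
  also have "?r * (fst R \<bullet> fst a) + snd R \<bullet> snd a =
     ?r * kulkarni_nomizu (conformal_form (g\<sigma> (fst z)) (H\<sigma> (fst z))) (fst a) (fst b)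
     - ?r * ?r * (g\<phi> (snd z) \<bullet> g\<phi> (snd z))
        * ((fst a \<bullet> fst a) * (fst b \<bullet> fst b) - (fst a \<bullet> fst b) * (fst a \<bullet> fst b))
     + ?r * ((fst a \<bullet> fst a) * mixed_form (g\<phi> (snd z)) (H\<phi> (snd z)) (g\<psi> (snd z)) (snd b) (snd b)
            + (fst b \<bullet> fst b) * mixed_form (g\<phi> (snd z)) (H\<phi> (snd z)) (g\<psi> (snd z)) (snd a) (snd a)
            - 2 * (fst a \<bullet> fst b) * mixed_form (g\<phi> (snd z)) (H\<phi> (snd z)) (g\<psi> (snd z)) (snd a) (snd b))
     + kulkarni_nomizu (conformal_form (g\<psi> (snd z)) (H\<psi> (snd z))) (snd a) (snd b)"
    unfolding R_def chr_def dchr_def by (rule warped_conn_curvature)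
  moreover have "Q z * (?r * A - ?r * ?r * B * C + ?r * D + E) =
      P z * A - (P z)\<^sup>2 / Q z * B * C + P z * D + Q z * E" for A B C D E
    using PQ_pos[of z] by (simp add: power2_eq_square field_simps)
  ultimately show ?thesis
    by (simp only: power2_eq_square)
qed

end


section \<open>Curvature sums over orthonormal frames\<close>

text \<open>
  As many orthonormal vectors as the dimension form a basis.
\<close>

lemma parseval:
  fixes E :: "nat \<Rightarrow> 'a::euclidean_space"
  assumes orth: "\<And>i j. i \<in> {1..DIM('a)} \<Longrightarrow> j \<in> {1..DIM('a)} \<Longrightarrow> E i \<bullet> E j = (if i = j then 1 else 0)"
  shows "(\<Sum>q=1..DIM('a). (E q \<bullet> u) * (E q \<bullet> v)) = u \<bullet> v"
proof -
  let ?I = "{1..DIM('a)}"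
  have inj: "inj_on E ?I"
    by (rule inj_onI) (metis orth zero_neq_one)
  have "independent (E ` ?I)"
  proof (rule pairwise_orthogonal_independent)
    show "pairwise orthogonal (E ` ?I)"
      unfolding pairwise_def orthogonal_def using orth by fastforce
    show "0 \<notin> E ` ?I" using orth by force
  qed
  moreover have "card (E ` ?I) = DIM('a)" using card_image[OF inj] by simp
  ultimately have span: "span (E ` ?I) = UNIV"
    by (metis card_ge_dim_independent dim_UNIV order_refl subset_UNIV top.extremum_uniqueI)
  \<comment> \<open>The remainder of the expansion of \<open>u\<close> is orthogonal to the basis, hence zero.\<close>
  define w where "w = u - (\<Sum>q\<in>?I. (E q \<bullet> u) *\<^sub>R E q)"
  have "orthogonal w x" if x: "x \<in> E ` ?I" for x
  proof -
    obtain i where i: "i \<in> ?I" "x = E i" using x by blast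
    have "(\<Sum>q\<in>?I. (E q \<bullet> u) * (E q \<bullet> E i)) = (\<Sum>q\<in>?I. if q = i then E q \<bullet> u else 0)"
      by (rule sum.cong) (use i orth in auto)
    then show ?thesis
      using i by (simp add: orthogonal_def w_def inner_diff_left inner_sum_left inner_commute[of u])
  qed
  then have "orthogonal w w" using span orthogonal_to_span by blast
  then have "u = (\<Sum>q\<in>?I. (E q \<bullet> u) *\<^sub>R E q)" by (simp add: w_def orthogonal_def)
  then have "u \<bullet> v = (\<Sum>q\<in>?I. (E q \<bullet> u) *\<^sub>R E q) \<bullet> v" by simp
  also have "\<dots> = (\<Sum>q\<in>?I. (E q \<bullet> u) * (E q \<bullet> v))" by (simp add: inner_sum_left)
  finally show ?thesis ..
qed

lemma sum_upper_Suc: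
  fixes f :: "nat \<Rightarrow> nat \<Rightarrow> real"
  shows "(\<Sum>p=1..Suc m. \<Sum>q=p+1..Suc m. f p q) = (\<Sum>p=1..m. \<Sum>q=p+1..m. f p q) + (\<Sum>p=1..m. f p (Suc m))"
  by (simp add: sum.distrib[symmetric])

lemma sum_upper_add:
  fixes c :: "nat \<Rightarrow> real"
  shows "(\<Sum>p=1..m. \<Sum>q=p+1..m. c p + c q) = (real m - 1) * (\<Sum>p=1..m. c p)"
proof (induction m)
  case (Suc m)
  then show ?case unfolding sum_upper_Suc by (simp add: sum.distrib algebra_simps)
qed simp

lemma sum_square_eq_upper:
  fixes f :: "nat \<Rightarrow> nat \<Rightarrow> real"
  assumes "\<And>p q. f p q = f q p"
  shows "(\<Sum>p=1..m. \<Sum>q=1..m. f p q) = 2 * (\<Sum>p=1..m. \<Sum>q=p+1..m. f p q) + (\<Sum>p=1..m. f p p)"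
proof (induction m)
  case (Suc m)
  have "(\<Sum>q=1..m. f (Suc m) q) = (\<Sum>p=1..m. f p (Suc m))"
    by (rule sum.cong) (use assms in auto)
  then show ?case
    using Suc unfolding sum_upper_Suc by (simp add: sum.distrib algebra_simps)
qed simp

lemma sum_upper_split:
  fixes f :: "nat \<Rightarrow> nat \<Rightarrow> real"
  shows "(\<Sum>p=1..m. \<Sum>q=p+1..k+m. f p q)
     = (\<Sum>p=1..m. \<Sum>q=p+1..m. f p q) + (\<Sum>p=1..m. \<Sum>q=m+1..k+m. f p q)"
proof -
  have "(\<Sum>q=p+1..k+m. f p q) = (\<Sum>q=p+1..m. f p q) + (\<Sum>q=m+1..k+m. f p q)" if "p \<in> {1..m}" for p
    using sum.ub_add_nat[of "p+1" m "f p" k] that by (simp add: add.commute)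
  then show ?thesis by (simp add: sum.distrib)
qed

lemma abs_prod_le:
  fixes a b c d \<alpha> r :: real
  assumes "\<bar>a\<bar> \<le> b * c" "\<bar>r\<bar> \<le> \<alpha> * d" "0 \<le> \<alpha>" "0 \<le> d" "d \<le> 1"
  shows "\<bar>2 * a * r\<bar> \<le> \<alpha> * (b\<^sup>2 + c\<^sup>2)"
proof -
  have bc: "0 \<le> b * c" using assms(1) by linarith
  have r: "\<bar>r\<bar> \<le> \<alpha>" using assms(2-5) by (meson mult_left_le order_trans)
  have "\<bar>a * r\<bar> \<le> (b * c) * \<alpha>"
    unfolding abs_mult by (rule mult_mono) (use assms(1) r bc in auto)
  also have "2 * \<dots> \<le> \<alpha> * (b\<^sup>2 + c\<^sup>2)"
    using mult_left_mono[OF sum_squares_bound[of b c] assms(3)] by (simp add: algebra_simps)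
  finally show ?thesis by (simp add: abs_mult)
qed

text \<open>
  The two components of an orthonormal frame of \<open>\<real>\<^sup>k \<times> \<real>\<^sup>m\<close>. The number \<open>w\<close> below measures how far the
  first \<open>m\<close> vectors are tilted away from the second factor; it vanishes if they span that factor.
\<close>

locale split_frame =
  fixes V :: "nat \<Rightarrow> 'v::euclidean_space" and X :: "nat \<Rightarrow> 'x::euclidean_space" and k m :: nat
  assumes dimV: "DIM('v) = k" and dimX: "DIM('x) = m"
    and orth: "\<And>i j. i \<in> {1..k+m} \<Longrightarrow> j \<in> {1..k+m} \<Longrightarrow> V i \<bullet> V j + X i \<bullet> X j = (if i = j then 1 else 0)"

begin

definition w :: real where "w = (\<Sum>p=1..m. V p \<bullet> V p)"

lemma w_nonneg: "w \<ge> 0" unfolding w_def by (simp add: sum_nonneg)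

lemma parseval_pair:
  "(\<Sum>q=1..k+m. (V q \<bullet> u + X q \<bullet> x) * (V q \<bullet> v + X q \<bullet> y)) = u \<bullet> v + x \<bullet> y"
  using parseval[of "\<lambda>q. (V q, X q)" "(u,x)" "(v,y)"] orth dimV dimX by simp

lemma parseval_V: "(\<Sum>q=1..k+m. (V q \<bullet> u) * (V q \<bullet> v)) = u \<bullet> v"
  using parseval_pair[of u 0 v 0] by simp

lemma parseval_X: "(\<Sum>q=1..k+m. (X q \<bullet> u) * (X q \<bullet> v)) = u \<bullet> v"
  using parseval_pair[of 0 u 0 v] by simp

text \<open>
  By Parseval's identity the second components of the whole frame resolve the identity of \<open>\<real>\<^sup>m\<close>.
\<close>

lemma trace_X:
  fixes B :: "'x \<Rightarrow> 'x \<Rightarrow> real"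
  assumes "bilinear B"
  shows "(\<Sum>q=1..k+m. B (X q) (X q)) = (\<Sum>b\<in>Basis. B b b)"
proof -
  have "B (X q) (X q) = (\<Sum>b\<in>Basis. \<Sum>c\<in>Basis. ((X q \<bullet> b) * (X q \<bullet> c)) * B b c)" for q
  proof -
    have "B (X q) (X q) = B (\<Sum>b\<in>Basis. (X q \<bullet> b) *\<^sub>R b) (\<Sum>c\<in>Basis. (X q \<bullet> c) *\<^sub>R c)"
      by (simp add: euclidean_representation)
    also have "\<dots> = (\<Sum>(b,c)\<in>Basis \<times> Basis. B ((X q \<bullet> b) *\<^sub>R b) ((X q \<bullet> c) *\<^sub>R c))"
      by (rule bilinear_sum[OF assms])
    also have "\<dots> = (\<Sum>b\<in>Basis. \<Sum>c\<in>Basis. ((X q \<bullet> b) * (X q \<bullet> c)) * B b c)"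
      by (simp add: sum.cartesian_product bilinear_lmul[OF assms] bilinear_rmul[OF assms] mult.left_commute mult.assoc)
    finally show ?thesis .
  qed
  then have "(\<Sum>q=1..k+m. B (X q) (X q)) = (\<Sum>q=1..k+m. \<Sum>b\<in>Basis. \<Sum>c\<in>Basis. ((X q \<bullet> b) * (X q \<bullet> c)) * B b c)"
    by simp
  also have "\<dots> = (\<Sum>b\<in>Basis. \<Sum>q=1..k+m. \<Sum>c\<in>Basis. ((X q \<bullet> b) * (X q \<bullet> c)) * B b c)"
    by (rule sum.swap)
  also have "\<dots> = (\<Sum>b\<in>Basis. \<Sum>c\<in>Basis. \<Sum>q=1..k+m. ((X q \<bullet> b) * (X q \<bullet> c)) * B b c)"
    by (intro sum.cong refl sum.swap)
  also have "\<dots> = (\<Sum>b\<in>Basis. \<Sum>c\<in>Basis. (b \<bullet> c) * B b c)"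
    by (simp only: sum_distrib_right[symmetric] parseval_X)
  also have "\<dots> = (\<Sum>b\<in>Basis. \<Sum>c\<in>Basis. if b = c then B b c else 0)"
    by (intro sum.cong refl) (simp add: inner_Basis)
  finally show ?thesis by simp
qed

lemma sum_split: "(\<Sum>q=1..k+m. f q) = (\<Sum>q=1..m. f q) + (\<Sum>q=m+1..k+m. f q)" for f :: "nat \<Rightarrow> real"
  using sum.ub_add_nat[of 1 m f k] by (simp add: add.commute)

lemma XX: "p \<in> {1..k+m} \<Longrightarrow> X p \<bullet> X p = 1 - V p \<bullet> V p"
  using orth[of p p] by simp

lemma VV_le: "p \<in> {1..k+m} \<Longrightarrow> V p \<bullet> V p \<le> 1"
  using XX[of p] inner_ge_zero[of "X p"] by linarith

lemma XX_le: "p \<in> {1..k+m} \<Longrightarrow> X p \<bullet> X p \<le> 1"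
  using XX[of p] inner_ge_zero[of "V p"] by linarith

lemma norm_VX_le: "p \<in> {1..k+m} \<Longrightarrow> norm (V p) \<le> 1" "p \<in> {1..k+m} \<Longrightarrow> norm (X p) \<le> 1"
  using VV_le[of p] XX_le[of p] by (auto simp: norm_le_square)

lemma sum_V: "(\<Sum>q=1..k+m. V q \<bullet> V q) = real k"
proof -
  have "(\<Sum>q=1..k+m. V q \<bullet> V q) = (\<Sum>q=1..k+m. \<Sum>b\<in>Basis. (V q \<bullet> b) * (V q \<bullet> b))"
    by (simp add: euclidean_inner[symmetric])
  also have "\<dots> = (\<Sum>b\<in>Basis. \<Sum>q=1..k+m. (V q \<bullet> b) * (V q \<bullet> b))" by (rule sum.swap)
  also have "\<dots> = (\<Sum>b\<in>(Basis::'v set). b \<bullet> b)" by (simp only: parseval_V)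
  finally show ?thesis by (simp add: dimV)
qed

text \<open>
  The second components of the whole frame have total squared length \<open>m\<close>, so what the first \<open>m\<close> vectors lose in the second factor is made up by the remaining \<open>k\<close> vectors.
\<close>

lemma sum_X_high: "(\<Sum>q=m+1..k+m. X q \<bullet> X q) = w"
proof -
  have "(\<Sum>q=1..k+m. X q \<bullet> X q) = (\<Sum>q=1..k+m. 1 - V q \<bullet> V q)"
    by (rule sum.cong) (auto simp: XX)
  then have "(\<Sum>q=1..k+m. X q \<bullet> X q) = real m" by (simp add: sum_subtractf sum_V del: One_nat_def)
  moreover have "(\<Sum>q=1..m. X q \<bullet> X q) = (\<Sum>q=1..m. 1 - V q \<bullet> V q)"
    by (rule sum.cong) (auto simp: XX)
  then have "(\<Sum>q=1..m. X q \<bullet> X q) = real m - w" by (simp add: sum_subtractf w_def)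
  ultimately show ?thesis using sum_split[of "\<lambda>q. X q \<bullet> X q"] by linarith
qed

definition area :: "nat \<Rightarrow> nat \<Rightarrow> real" where
  "area p q = (V p \<bullet> V p) * (V q \<bullet> V q) - (V p \<bullet> V q)\<^sup>2"

lemma area_nonneg: "area p q \<ge> 0"
  unfolding area_def using Cauchy_Schwarz_ineq[of "V p" "V q"] by simp

text \<open>
  This is the gain from the curvature of the fibre. By Parseval's identity the sum over all \<open>q\<close> of the
  squared areas for a fixed \<open>p\<close> is \<open>(k - 1) * |V p|\<^sup>2\<close>. Each pair among the first \<open>m\<close> vectors is met twice
  when \<open>p\<close> runs up to \<open>m\<close>, which costs at most a factor two.
\<close>

lemma sum_area: "(\<Sum>p=1..m. \<Sum>q=p+1..k+m. area p q) \<ge> (real k - 1) / 2 * w"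
proof -
  have "(\<Sum>q=1..k+m. area p q) = (real k - 1) * (V p \<bullet> V p)" for p
  proof -
    have "(\<Sum>q=1..k+m. area p q) = (V p \<bullet> V p) * (\<Sum>q=1..k+m. V q \<bullet> V q) - (\<Sum>q=1..k+m. (V q \<bullet> V p) * (V q \<bullet> V p))"
      unfolding area_def by (simp add: sum_subtractf sum_distrib_left power2_eq_square inner_commute)
    then show ?thesis unfolding sum_V parseval_V by (simp add: algebra_simps)
  qed
  then have "(real k - 1) * w = (\<Sum>p=1..m. \<Sum>q=1..k+m. area p q)"
    by (simp add: w_def sum_distrib_left)
  also have "\<dots> = (\<Sum>p=1..m. \<Sum>q=1..m. area p q) + (\<Sum>p=1..m. \<Sum>q=m+1..k+m. area p q)"
    unfolding sum_split by (simp add: sum.distrib)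
  also have "(\<Sum>p=1..m. \<Sum>q=1..m. area p q) = 2 * (\<Sum>p=1..m. \<Sum>q=p+1..m. area p q)"
    by (subst sum_square_eq_upper) (auto simp: area_def inner_commute mult.commute power2_eq_square)
  also have "\<dots> + (\<Sum>p=1..m. \<Sum>q=m+1..k+m. area p q) \<le> 2 * (\<Sum>p=1..m. \<Sum>q=p+1..k+m. area p q)"
    unfolding sum_upper_split using area_nonneg by (simp add: sum_nonneg)
  finally show ?thesis by simp
qed

text \<open>
  The trace over the whole frame is the full trace, and the vectors beyond the first \<open>m\<close> contribute at most
  \<open>\<alpha> * w\<close> to it.
\<close>

lemma sum_diag_low:
  assumes "bilinear A" and A: "\<And>x y. \<bar>A x y\<bar> \<le> \<alpha> * norm x * norm y"
  shows "\<bar>(\<Sum>p=1..m. A (X p) (X p)) - (\<Sum>b\<in>Basis. A b b)\<bar> \<le> \<alpha> * w"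
proof -
  have "(\<Sum>p=1..m. A (X p) (X p)) - (\<Sum>b\<in>Basis. A b b) = - (\<Sum>q=m+1..k+m. A (X q) (X q))"
    using trace_X[OF assms(1)] sum_split[of "\<lambda>q. A (X q) (X q)"] by linarith
  also have "\<bar>\<dots>\<bar> \<le> (\<Sum>q=m+1..k+m. \<alpha> * (X q \<bullet> X q))"
    unfolding abs_minus_cancel
    by (rule order_trans[OF sum_abs sum_mono]) (use A in \<open>simp add: dot_square_norm power2_eq_square mult.assoc\<close>)
  also have "\<dots> = \<alpha> * w" by (simp only: sum_distrib_left[symmetric] sum_X_high)
  finally show ?thesis .
qed

definition mixed :: "('x \<Rightarrow> 'x \<Rightarrow> real) \<Rightarrow> nat \<Rightarrow> nat \<Rightarrow> real" where
  "mixed A p q = (V p \<bullet> V p) * A (X q) (X q) + (V q \<bullet> V q) * A (X p) (X p) - 2 * (V p \<bullet> V q) * A (X p) (X q)"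

text \<open>
  Two vectors among the first \<open>m\<close> have first components of total size \<open>w\<close>, so their mixed curvature is of
  that order. For \<open>p \<le> m < q\<close> the equation \<open>|V q|\<^sup>2 = 1 - |X q|\<^sup>2\<close> leaves \<open>A (X p) (X p)\<close> up to terms that
  also add up to multiples of \<open>w\<close>; each of these traces occurs \<open>k\<close> times.
\<close>

lemma sum_mixed:
  assumes A': "bilinear A" and A: "\<And>x y. \<bar>A x y\<bar> \<le> \<alpha> * norm x * norm y" and \<alpha>: "\<alpha> \<ge> 0"
  shows "(\<Sum>p=1..m. \<Sum>q=p+1..k+m. mixed A p q) \<ge> real k * (\<Sum>b\<in>Basis. A b b) - 9 * (real k + real m) * \<alpha> * w"
proof -
  have sq: "V p \<bullet> V p = (norm (V p))\<^sup>2" "X p \<bullet> X p = (norm (X p))\<^sup>2" for p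
    by (simp_all add: dot_square_norm)
  have AX: "\<bar>A (X p) (X q)\<bar> \<le> \<alpha> * (norm (X p) * norm (X q))" for p q
    using A[of "X p" "X q"] by (simp add: mult.assoc)
  have AXpp: "\<bar>A (X p) (X p)\<bar> \<le> \<alpha> * (X p \<bullet> X p)" for p
    using AX[of p p] by (simp add: sq power2_eq_square)
  have AX1: "\<bar>A (X p) (X p)\<bar> \<le> \<alpha>" if "p \<in> {1..k+m}" for p
    using AXpp[of p] XX_le[OF that] \<alpha> by (meson mult_left_le order_trans)
  have low: "mixed A p q \<ge> - 2 * \<alpha> * (V p \<bullet> V p + V q \<bullet> V q)"
    if p: "p \<in> {1..k+m}" and q: "q \<in> {1..k+m}" for p q
  proof -
    have "\<bar>2 * (V p \<bullet> V q) * A (X p) (X q)\<bar> \<le> \<alpha> * ((norm (V p))\<^sup>2 + (norm (V q))\<^sup>2)"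
      by (rule abs_prod_le[OF Cauchy_Schwarz_ineq2 AX \<alpha>])
         (use norm_VX_le(2)[OF p] norm_VX_le(2)[OF q] in \<open>auto intro: mult_le_one\<close>)
    moreover have "\<bar>(V p \<bullet> V p) * A (X q) (X q)\<bar> \<le> (V p \<bullet> V p) * \<alpha>"
      unfolding abs_mult by (simp add: mult_left_mono AX1[OF q])
    moreover have "\<bar>(V q \<bullet> V q) * A (X p) (X p)\<bar> \<le> (V q \<bullet> V q) * \<alpha>"
      unfolding abs_mult by (simp add: mult_left_mono AX1[OF p])
    ultimately show ?thesis unfolding mixed_def by (simp add: sq algebra_simps)
  qed
  have high: "mixed A p q \<ge> A (X p) (X p) - 2 * \<alpha> * (V p \<bullet> V p + X q \<bullet> X q)"
    if p: "p \<in> {1..k+m}" and q: "q \<in> {1..k+m}" for p q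
  proof -
    have "\<bar>A (X p) (X q)\<bar> * 1 \<le> \<alpha> * norm (X q)"
      using mult_mono[OF norm_VX_le(2)[OF p] order_refl[of "\<alpha> * norm (X q)"]] \<alpha> AX[of p q]
      by (simp add: algebra_simps)
    then have "\<bar>2 * (V p \<bullet> V q) * A (X p) (X q)\<bar> \<le> \<alpha> * ((norm (V p))\<^sup>2 + (norm (X q))\<^sup>2)"
    proof -
      assume r: "\<bar>A (X p) (X q)\<bar> * 1 \<le> \<alpha> * norm (X q)"
      have "\<bar>V p \<bullet> V q\<bar> \<le> norm (V p)"
        using Cauchy_Schwarz_ineq2[of "V p" "V q"] norm_VX_le(1)[OF q]
        by (meson mult_left_le norm_ge_zero order_trans)
      then have "\<bar>(V p \<bullet> V q) * A (X p) (X q)\<bar> \<le> norm (V p) * (\<alpha> * norm (X q))"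
        unfolding abs_mult by (intro mult_mono) (use r in auto)
      moreover have "2 * (norm (V p) * (\<alpha> * norm (X q))) \<le> \<alpha> * ((norm (V p))\<^sup>2 + (norm (X q))\<^sup>2)"
        using mult_left_mono[OF sum_squares_bound[of "norm (V p)" "norm (X q)"] \<alpha>] by (simp add: algebra_simps)
      ultimately show ?thesis by (simp add: abs_mult)
    qed
    moreover have "\<bar>(V p \<bullet> V p) * A (X q) (X q)\<bar> \<le> (V p \<bullet> V p) * \<alpha>"
      unfolding abs_mult by (simp add: mult_left_mono AX1[OF q])
    moreover have "(V q \<bullet> V q) * A (X p) (X p) = A (X p) (X p) - (X q \<bullet> X q) * A (X p) (X p)"
      unfolding XX[OF q] by (simp add: algebra_simps)
    moreover have "\<bar>(X q \<bullet> X q) * A (X p) (X p)\<bar> \<le> (X q \<bullet> X q) * \<alpha>"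
      unfolding abs_mult by (simp add: mult_left_mono AX1[OF p])
    ultimately show ?thesis unfolding mixed_def by (simp add: sq algebra_simps)
  qed
  have "(\<Sum>p=1..m. \<Sum>q=p+1..m. mixed A p q) \<ge> (\<Sum>p=1..m. \<Sum>q=p+1..m. - 2 * \<alpha> * (V p \<bullet> V p) + - 2 * \<alpha> * (V q \<bullet> V q))"
    by (intro sum_mono) (use low in \<open>auto simp: algebra_simps\<close>)
  also have "(\<Sum>p=1..m. \<Sum>q=p+1..m. - 2 * \<alpha> * (V p \<bullet> V p) + - 2 * \<alpha> * (V q \<bullet> V q)) = (real m - 1) * (- 2 * \<alpha> * w)"
    unfolding sum_upper_add w_def by (simp only: sum_distrib_left)
  finally have 1: "(\<Sum>p=1..m. \<Sum>q=p+1..m. mixed A p q) \<ge> - 2 * real m * \<alpha> * w"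
    using \<alpha> w_nonneg by (simp add: algebra_simps) (smt (verit) mult_nonneg_nonneg)
  have "(\<Sum>p=1..m. \<Sum>q=m+1..k+m. mixed A p q)
      \<ge> (\<Sum>p=1..m. \<Sum>q=m+1..k+m. (A (X p) (X p) - 2 * \<alpha> * (V p \<bullet> V p)) - 2 * \<alpha> * (X q \<bullet> X q))"
    by (intro sum_mono) (use high in \<open>auto simp: algebra_simps\<close>)
  also have "(\<Sum>p=1..m. \<Sum>q=m+1..k+m. (A (X p) (X p) - 2 * \<alpha> * (V p \<bullet> V p)) - 2 * \<alpha> * (X q \<bullet> X q))
     = real k * ((\<Sum>p=1..m. A (X p) (X p)) - 2 * \<alpha> * w) - 2 * \<alpha> * real m * w"
    by (simp add: sum_subtractf sum_distrib_left[symmetric] sum_X_high[simplified] w_def)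
  finally have 2: "(\<Sum>p=1..m. \<Sum>q=m+1..k+m. mixed A p q)
      \<ge> real k * ((\<Sum>p=1..m. A (X p) (X p)) - 2 * \<alpha> * w) - 2 * \<alpha> * real m * w" .
  have 3: "real k * (\<Sum>p=1..m. A (X p) (X p)) \<ge> real k * ((\<Sum>b\<in>Basis. A b b) - \<alpha> * w)"
    using sum_diag_low[OF A' A] by (intro mult_left_mono) auto
  have "0 \<le> real k * \<alpha> * w" "0 \<le> real m * \<alpha> * w" using \<alpha> w_nonneg by auto
  then show ?thesis
    unfolding sum_upper_split using 1 2 3 by (simp add: algebra_simps)
qed

text \<open>
  For \<open>p, q \<le> m\<close> the vectors \<open>X p\<close>, \<open>X q\<close> are orthonormal up to \<open>V p\<close>, \<open>V q\<close>, which leaves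
  \<open>B (X p) (X p) + B (X q) (X q)\<close>; summed over the pairs this is \<open>m - 1\<close> times the trace. The vectors with
  index beyond \<open>m\<close> have small second components.
\<close>

lemma sum_kulkarni_nomizu:
  assumes B': "bilinear B" and B: "\<And>x y. \<bar>B x y\<bar> \<le> \<beta> * norm x * norm y" and \<beta>: "\<beta> \<ge> 0" and m: "m \<ge> 1"
  shows "(\<Sum>p=1..m. \<Sum>q=p+1..k+m. kulkarni_nomizu B (X p) (X q))
    \<ge> (real m - 1) * (\<Sum>b\<in>Basis. B b b) - 9 * real m * \<beta> * w"
proof -
  have sq: "V p \<bullet> V p = (norm (V p))\<^sup>2" "X p \<bullet> X p = (norm (X p))\<^sup>2" for p
    by (simp_all add: dot_square_norm)
  have BX: "\<bar>B (X p) (X q)\<bar> \<le> \<beta> * (norm (X p) * norm (X q))" for p q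
    using B[of "X p" "X q"] by (simp add: mult.assoc)
  have BXpp: "\<bar>B (X p) (X p)\<bar> \<le> \<beta> * (X p \<bullet> X p)" for p
    using BX[of p p] by (simp add: sq power2_eq_square)
  have BX1: "\<bar>B (X p) (X p)\<bar> \<le> \<beta>" if "p \<in> {1..k+m}" for p
    using BXpp[of p] XX_le[OF that] \<beta> by (meson mult_left_le order_trans)
  have low: "kulkarni_nomizu B (X p) (X q) \<ge> B (X p) (X p) + B (X q) (X q) - 2 * \<beta> * (V p \<bullet> V p + V q \<bullet> V q)"
    if p: "p \<in> {1..k+m}" and q: "q \<in> {1..k+m}" and "p \<noteq> q" for p q
  proof -
    have "X p \<bullet> X q = - (V p \<bullet> V q)" using orth[OF p q] \<open>p \<noteq> q\<close> by simp
    moreover have "\<bar>2 * (V p \<bullet> V q) * B (X p) (X q)\<bar> \<le> \<beta> * ((norm (V p))\<^sup>2 + (norm (V q))\<^sup>2)"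
      by (rule abs_prod_le[OF Cauchy_Schwarz_ineq2 BX \<beta>])
         (use norm_VX_le(2)[OF p] norm_VX_le(2)[OF q] in \<open>auto intro: mult_le_one\<close>)
    moreover have "\<bar>(V q \<bullet> V q) * B (X p) (X p)\<bar> \<le> (V q \<bullet> V q) * \<beta>"
      unfolding abs_mult by (simp add: mult_left_mono BX1[OF p])
    moreover have "\<bar>(V p \<bullet> V p) * B (X q) (X q)\<bar> \<le> (V p \<bullet> V p) * \<beta>"
      unfolding abs_mult by (simp add: mult_left_mono BX1[OF q])
    ultimately show ?thesis unfolding kulkarni_nomizu_def XX[OF p] XX[OF q] by (simp add: sq algebra_simps)
  qed
  have high: "kulkarni_nomizu B (X p) (X q) \<ge> - 4 * \<beta> * (X q \<bullet> X q)"
    if p: "p \<in> {1..k+m}" and q: "q \<in> {1..k+m}" for p q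
  proof -
    have "\<bar>B (X p) (X q)\<bar> \<le> \<beta> * norm (X q)"
      using mult_mono[OF norm_VX_le(2)[OF p] order_refl[of "\<beta> * norm (X q)"]] \<beta> BX[of p q]
      by (simp add: algebra_simps)
    moreover have "\<bar>X p \<bullet> X q\<bar> \<le> norm (X q)"
      using Cauchy_Schwarz_ineq2[of "X p" "X q"] norm_VX_le(2)[OF p]
      by (meson mult_left_le_one_le norm_ge_zero order_trans)
    ultimately have "\<bar>B (X p) (X q)\<bar> * \<bar>X p \<bullet> X q\<bar> \<le> (\<beta> * norm (X q)) * norm (X q)"
      by (intro mult_mono) (use \<beta> in auto)
    then have "\<bar>B (X p) (X q) * (X p \<bullet> X q)\<bar> \<le> \<beta> * (X q \<bullet> X q)"
      by (simp add: abs_mult sq power2_eq_square mult.assoc)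
    moreover have "\<bar>B (X p) (X p) * (X q \<bullet> X q)\<bar> \<le> \<beta> * (X q \<bullet> X q)"
      unfolding abs_mult by (simp add: mult_right_mono BX1[OF p])
    moreover have "\<bar>B (X q) (X q) * (X p \<bullet> X p)\<bar> \<le> \<beta> * (X q \<bullet> X q)"
      using mult_mono[OF BXpp[of q] XX_le[OF p]] \<beta> unfolding abs_mult by simp
    ultimately show ?thesis unfolding kulkarni_nomizu_def by (simp add: mult.assoc)
  qed
  have "(\<Sum>p=1..m. \<Sum>q=p+1..m. kulkarni_nomizu B (X p) (X q))
     \<ge> (\<Sum>p=1..m. \<Sum>q=p+1..m. (B (X p) (X p) - 2 * \<beta> * (V p \<bullet> V p)) + (B (X q) (X q) - 2 * \<beta> * (V q \<bullet> V q)))"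
    by (intro sum_mono) (use low in \<open>fastforce simp: algebra_simps\<close>)
  also have "(\<Sum>p=1..m. \<Sum>q=p+1..m. (B (X p) (X p) - 2 * \<beta> * (V p \<bullet> V p)) + (B (X q) (X q) - 2 * \<beta> * (V q \<bullet> V q)))
      = (real m - 1) * ((\<Sum>p=1..m. B (X p) (X p)) - 2 * \<beta> * w)"
    unfolding sum_upper_add w_def by (simp only: sum_distrib_left sum_subtractf)
  finally have 1: "(\<Sum>p=1..m. \<Sum>q=p+1..m. kulkarni_nomizu B (X p) (X q))
      \<ge> (real m - 1) * ((\<Sum>p=1..m. B (X p) (X p)) - 2 * \<beta> * w)" .
  have "(\<Sum>p=1..m. \<Sum>q=m+1..k+m. kulkarni_nomizu B (X p) (X q)) \<ge> (\<Sum>p=1..m. \<Sum>q=m+1..k+m. - 4 * \<beta> * (X q \<bullet> X q))"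
    by (intro sum_mono high) auto
  also have "(\<Sum>p=1..m. \<Sum>q=m+1..k+m. - 4 * \<beta> * (X q \<bullet> X q)) = - 4 * \<beta> * real m * w"
    by (simp only: sum_distrib_left[symmetric] sum_X_high) simp
  finally have 2: "(\<Sum>p=1..m. \<Sum>q=m+1..k+m. kulkarni_nomizu B (X p) (X q)) \<ge> - 4 * \<beta> * real m * w" .
  have 3: "(real m - 1) * (\<Sum>p=1..m. B (X p) (X p)) \<ge> (real m - 1) * ((\<Sum>b\<in>Basis. B b b) - \<beta> * w)"
    using sum_diag_low[OF B' B] m by (intro mult_left_mono) auto
  have "0 \<le> \<beta> * w" "0 \<le> real m * \<beta> * w" using \<beta> w_nonneg by auto
  then show ?thesis
    unfolding sum_upper_split using 1 2 3 by (simp add: algebra_simps)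
qed

end


section \<open>Tilted frames and small fibres\<close>

lemma bilinear_mixed_form: "linear H \<Longrightarrow> bilinear (mixed_form g H q)"
  unfolding bilinear_def mixed_form_def
  by (auto simp: linear_iff inner_add_left inner_add_right algebra_simps)

lemma bilinear_conformal_form: "linear H \<Longrightarrow> bilinear (conformal_form g H)"
  unfolding bilinear_def conformal_form_def
  by (auto simp: linear_iff inner_add_left inner_add_right algebra_simps add_divide_distrib)

lemma bilinear_divide: "bilinear B \<Longrightarrow> bilinear (\<lambda>x y. B x y / c :: real)"
  unfolding bilinear_def by (auto simp: linear_iff add_divide_distrib)

lemma abs_inner_prod_le:
  fixes g q a b :: "'a::real_inner"
  assumes "norm g \<le> M" "norm q \<le> M"
  shows "\<bar>(g \<bullet> a) * (q \<bullet> b)\<bar> \<le> M\<^sup>2 * norm a * norm b"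
proof -
  have M: "0 \<le> M" using assms(1) norm_ge_zero order_trans by blast
  have "\<bar>g \<bullet> a\<bar> \<le> M * norm a" "\<bar>q \<bullet> b\<bar> \<le> M * norm b"
    using assms by (meson Cauchy_Schwarz_ineq2 mult_right_mono norm_ge_zero order_trans)+
  then have "\<bar>g \<bullet> a\<bar> * \<bar>q \<bullet> b\<bar> \<le> (M * norm a) * (M * norm b)"
    using M by (intro mult_mono) auto
  then show ?thesis by (simp add: abs_mult power2_eq_square algebra_simps)
qed

lemma abs_inner_mult_le:
  fixes g q a b :: "'a::real_inner"
  assumes "norm g \<le> M" "norm q \<le> M"
  shows "\<bar>(g \<bullet> q) * (a \<bullet> b)\<bar> \<le> M\<^sup>2 * norm a * norm b"
proof -
  have M: "0 \<le> M" using assms(1) norm_ge_zero order_trans by blast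
  have "\<bar>g \<bullet> q\<bar> \<le> norm g * norm q" by (rule Cauchy_Schwarz_ineq2)
  also have "\<dots> \<le> M * M" using assms M by (intro mult_mono) auto
  finally have "\<bar>g \<bullet> q\<bar> * \<bar>a \<bullet> b\<bar> \<le> (M * M) * (norm a * norm b)"
    using M by (intro mult_mono Cauchy_Schwarz_ineq2) auto
  then show ?thesis by (simp add: abs_mult power2_eq_square algebra_simps)
qed

lemma abs_hess_inner_le:
  fixes a b :: "'a::real_inner"
  assumes "norm (H a) \<le> M * norm a" "1 \<le> M"
  shows "\<bar>H a \<bullet> b\<bar> \<le> M\<^sup>2 * norm a * norm b"
proof -
  have "\<bar>H a \<bullet> b\<bar> \<le> norm (H a) * norm b" by (rule Cauchy_Schwarz_ineq2)
  also have "\<dots> \<le> M * norm a * norm b" using assms by (intro mult_right_mono) auto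
  also have "\<dots> \<le> M\<^sup>2 * norm a * norm b"
    using assms(2) by (intro mult_right_mono) (auto simp: power2_eq_square)
  finally show ?thesis .
qed

lemma abs_mixed_form_le:
  assumes "norm g \<le> M" "norm q \<le> M" "\<And>h. norm (H h) \<le> M * norm h" "1 \<le> M"
  shows "\<bar>mixed_form g H q a b\<bar> \<le> 5 * M\<^sup>2 * norm a * norm b"
  using abs_hess_inner_le[where H = H, OF assms(3,4), of a b] abs_inner_prod_le[OF assms(1,1), of a b]
    abs_inner_prod_le[OF assms(2,1), of a b] abs_inner_prod_le[OF assms(1,2), of a b]
    abs_inner_mult_le[OF assms(2,1), of a b]
  unfolding mixed_form_def by (simp only: mult.commute[of "q \<bullet> b"])

lemma abs_conformal_form_le:
  assumes "norm g \<le> M" "\<And>h. norm (H h) \<le> M * norm h" "1 \<le> M"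
  shows "\<bar>conformal_form g H a b\<bar> \<le> 3 * M\<^sup>2 * norm a * norm b"
  using abs_hess_inner_le[where H = H, OF assms(2,3), of a b] abs_inner_prod_le[OF assms(1,1), of a b]
    abs_inner_mult_le[OF assms(1,1), of a b]
  unfolding conformal_form_def by (simp only: times_divide_eq_left)

text \<open>
  If the first \<open>m\<close> frame vectors span the base, their curvature sum is the expression in
  \<open>trace\<close>, divided by \<open>Q\<close>. For a general frame the sum changes by at most \<open>72 (k + m) M\<^sup>3 w\<close>, while the curvature
  of the fibre, of size \<open>1 / (\<epsilon>\<^sup>2 * exp (2 * \<phi>))\<close>, adds a larger multiple of \<open>w\<close> when \<open>\<epsilon>\<close> is small compared with the
  bound \<open>M\<close>. So only the frames adapted to the base matter.
\<close>

lemma (in doubly_warped) frame_curvature_pos: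
  fixes z :: "'v \<times> 'x"
  defines "y \<equiv> fst z" and "x \<equiv> snd z"
  assumes k: "DIM('v) = k" "k \<ge> 2" and m: "DIM('x) = m" "m \<ge> 1" and \<epsilon>: "\<epsilon> > 0" and M: "M \<ge> 1"
    and sphere: "\<And>a b. conformal_form (g\<sigma> y) (H\<sigma> y) a b = exp (2 * \<sigma> y) / (2 * \<epsilon>\<^sup>2) * (a \<bullet> b)"
    and bounds: "norm (g\<phi> x) \<le> M" "norm (g\<psi> x) \<le> M"
      "\<And>h. norm (H\<phi> x h) \<le> M * norm h" "\<And>h. norm (H\<psi> x h) \<le> M * norm h"
      "exp (2 * \<phi> x) \<le> M" "exp (- 2 * \<psi> x) \<le> M"
    and small: "\<epsilon>\<^sup>2 * ((1 + 144 * (real k + real m)) * M ^ 4) \<le> 1"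
    and trace: "real k * (\<Sum>b\<in>Basis. mixed_form (g\<phi> x) (H\<phi> x) (g\<psi> x) b b)
      + (real m - 1) * (\<Sum>b\<in>Basis. conformal_form (g\<psi> x) (H\<psi> x) b b) > 0"
    and frame: "orthonormal_frame G z e"
  shows "intermediate_curvature m G z e > 0"
proof -
  define V where "V i = sqrt (P z) *\<^sub>R fst (e i)" for i
  define X where "X i = sqrt (Q z) *\<^sub>R snd (e i)" for i
  note PQ = PQ_pos[of z]
  have inner_V: "V i \<bullet> V j = P z * (fst (e i) \<bullet> fst (e j))" and inner_X: "X i \<bullet> X j = Q z * (snd (e i) \<bullet> snd (e j))" for i j
    using PQ by (simp_all add: V_def X_def)
  interpret split_frame V X k m
    by unfold_locales (use k m frame in \<open>auto simp: inner_V inner_X orthonormal_frame_def G_def\<close>)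
  define A where "A a b = mixed_form (g\<phi> x) (H\<phi> x) (g\<psi> x) a b / Q z" for a b
  define B where "B a b = conformal_form (g\<psi> x) (H\<psi> x) a b / Q z" for a b
  define l :: real where "l = 1 / (\<epsilon>\<^sup>2 * exp (2 * \<phi> x)) - (g\<phi> x \<bullet> g\<phi> x) / Q z"
  have Q: "1 / Q z \<le> M" using bounds(6) unfolding Q_def x_def by (simp add: exp_minus field_simps)
  have lin: "linear (H\<phi> x)" "linear (H\<psi> x)"
    using has_derivative_linear[OF dd\<phi>] has_derivative_linear[OF dd\<psi>] by auto
  have bilA: "bilinear A" and bilB: "bilinear B"
    unfolding A_def B_def
    by (intro bilinear_divide bilinear_mixed_form bilinear_conformal_form lin)+
  \<comment> \<open>Passing from \<open>e\<close> to the normalized components \<open>V\<close>, \<open>X\<close> divides the base forms by \<open>Q\<close>.\<close>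
  have divQ: "\<bar>r / Q z\<bar> \<le> c * M ^ 3 * norm a * norm b"
    if "\<bar>r\<bar> \<le> c * M\<^sup>2 * norm a * norm b" for r c and a b :: 'x
  proof -
    have "\<bar>r / Q z\<bar> = \<bar>r\<bar> * (1 / Q z)" using PQ by (simp add: abs_divide)
    also have "\<dots> \<le> (c * M\<^sup>2 * norm a * norm b) * M"
      by (rule mult_mono) (use that Q PQ in auto)
    finally show ?thesis by (simp add: power3_eq_cube power2_eq_square algebra_simps)
  qed
  have Abd: "\<bar>A a b\<bar> \<le> 5 * M ^ 3 * norm a * norm b" for a b
    unfolding A_def by (rule divQ, rule abs_mixed_form_le[OF bounds(1,2,3) M])
  have Bbd: "\<bar>B a b\<bar> \<le> 3 * M ^ 3 * norm a * norm b" for a b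
    unfolding B_def by (rule divQ, rule abs_conformal_form_le[OF bounds(2,4) M])
  have R: "riemann G z (e p) (e q) (e q) (e p) = l * area p q + mixed A p q + kulkarni_nomizu B (X p) (X q)"
    for p q
  proof -
    define a1 b1 a2 b2 where ab: "a1 = fst (e p)" "b1 = fst (e q)" "a2 = snd (e p)" "b2 = snd (e q)"
    let ?area = "(a1 \<bullet> a1) * (b1 \<bullet> b1) - (a1 \<bullet> b1)\<^sup>2"
    have Pz: "P z = exp (2 * \<sigma> y) * exp (2 * \<phi> x)"
      unfolding P_def y_def x_def by (simp add: exp_add[symmetric] algebra_simps)
    have kn: "kulkarni_nomizu (conformal_form (g\<sigma> y) (H\<sigma> y)) a1 b1 = exp (2 * \<sigma> y) / \<epsilon>\<^sup>2 * ?area"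
      unfolding kulkarni_nomizu_def sphere using \<epsilon> by (simp add: power2_eq_square inner_commute field_simps)
    have "P z * kulkarni_nomizu (conformal_form (g\<sigma> y) (H\<sigma> y)) a1 b1
        = 1 / (\<epsilon>\<^sup>2 * exp (2 * \<phi> x)) * ((P z)\<^sup>2 * ?area)"
      unfolding kn Pz by (simp add: power2_eq_square)
    moreover have ar: "area p q = (P z)\<^sup>2 * ?area"
      unfolding area_def inner_V ab by (simp add: power2_eq_square algebra_simps)
    ultimately have 1: "P z * kulkarni_nomizu (conformal_form (g\<sigma> y) (H\<sigma> y)) a1 b1
        - (P z)\<^sup>2 / Q z * (g\<phi> x \<bullet> g\<phi> x) * ?area = l * area p q"
      unfolding l_def ar by (simp add: left_diff_distrib)
    have AX: "A (X i) (X j) = mixed_form (g\<phi> x) (H\<phi> x) (g\<psi> x) (snd (e i)) (snd (e j))"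
      and BX: "B (X i) (X j) = conformal_form (g\<psi> x) (H\<psi> x) (snd (e i)) (snd (e j))" for i j
      using PQ unfolding X_def bilinear_lmul[OF bilA] bilinear_rmul[OF bilA] bilinear_lmul[OF bilB] bilinear_rmul[OF bilB]
      by (simp_all add: A_def B_def mult.assoc[symmetric])
    have 2: "P z * ((a1 \<bullet> a1) * mixed_form (g\<phi> x) (H\<phi> x) (g\<psi> x) b2 b2
            + (b1 \<bullet> b1) * mixed_form (g\<phi> x) (H\<phi> x) (g\<psi> x) a2 a2
            - 2 * (a1 \<bullet> b1) * mixed_form (g\<phi> x) (H\<phi> x) (g\<psi> x) a2 b2) = mixed A p q"
      unfolding mixed_def inner_V AX ab by (simp add: algebra_simps)
    have 3: "Q z * kulkarni_nomizu (conformal_form (g\<psi> x) (H\<psi> x)) a2 b2 = kulkarni_nomizu B (X p) (X q)"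
      unfolding kulkarni_nomizu_def inner_X BX ab by (simp add: algebra_simps)
    show ?thesis
      unfolding riemann_G y_def[symmetric] x_def[symmetric] ab[symmetric] 1 2 3 ..
  qed
  have curv: "l \<ge> 144 * (real k + real m) * M ^ 3"
  proof -
    have "(g\<phi> x \<bullet> g\<phi> x) / Q z \<le> M\<^sup>2 * M"
    proof -
      have "g\<phi> x \<bullet> g\<phi> x \<le> M\<^sup>2" using bounds(1) by (simp add: dot_square_norm power_mono)
      then have "(g\<phi> x \<bullet> g\<phi> x) * (1 / Q z) \<le> M\<^sup>2 * M"
        using Q PQ by (intro mult_mono) auto
      then show ?thesis by simp
    qed
    moreover have "(1 + 144 * (real k + real m)) * M ^ 3 \<le> 1 / (\<epsilon>\<^sup>2 * exp (2 * \<phi> x))"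
    proof -
      have "(1 + 144 * (real k + real m)) * M ^ 3 * (\<epsilon>\<^sup>2 * exp (2 * \<phi> x))
         \<le> (1 + 144 * (real k + real m)) * M ^ 3 * (\<epsilon>\<^sup>2 * M)"
        using bounds(5) M by (intro mult_left_mono) auto
      also have "\<dots> = \<epsilon>\<^sup>2 * ((1 + 144 * (real k + real m)) * M ^ 4)"
        by (simp add: power_numeral_reduce algebra_simps)
      finally have "(1 + 144 * (real k + real m)) * M ^ 3 * (\<epsilon>\<^sup>2 * exp (2 * \<phi> x)) \<le> 1"
        using small by (rule order_trans)
      moreover have "0 < \<epsilon>\<^sup>2 * exp (2 * \<phi> x)" using \<epsilon> by simp
      ultimately show ?thesis by (simp only: pos_le_divide_eq)
    qed
    ultimately show ?thesis unfolding l_def by (simp add: algebra_simps power3_eq_cube power2_eq_square)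
  qed
  let ?trA = "\<Sum>b\<in>Basis. A b b" and ?trB = "\<Sum>b\<in>Basis. B b b"
  have M3: "0 \<le> 5 * M ^ 3" "0 \<le> 3 * M ^ 3" using M by auto
  have l0: "0 \<le> l" using curv M by (smt (verit) mult_nonneg_nonneg of_nat_0_le_iff zero_le_power)
  have "intermediate_curvature m G z e
      = (\<Sum>p=1..m. \<Sum>q=p+1..k+m. l * area p q + mixed A p q + kulkarni_nomizu B (X p) (X q))"
    unfolding intermediate_curvature_def R using k m by simp
  also have "\<dots> = l * (\<Sum>p=1..m. \<Sum>q=p+1..k+m. area p q) + (\<Sum>p=1..m. \<Sum>q=p+1..k+m. mixed A p q)
      + (\<Sum>p=1..m. \<Sum>q=p+1..k+m. kulkarni_nomizu B (X p) (X q))"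
    by (simp only: sum.distrib sum_distrib_left)
  also have "\<dots> \<ge> l * ((real k - 1) / 2 * w) + (real k * ?trA - 9 * (real k + real m) * (5 * M ^ 3) * w)
      + ((real m - 1) * ?trB - 9 * real m * (3 * M ^ 3) * w)"
    by (intro add_mono mult_left_mono sum_area sum_mixed sum_kulkarni_nomizu bilA bilB Abd Bbd M3 m l0)
  finally have main: "intermediate_curvature m G z e \<ge> l * ((real k - 1) / 2 * w)
      + (real k * ?trA - 9 * (real k + real m) * (5 * M ^ 3) * w)
      + ((real m - 1) * ?trB - 9 * real m * (3 * M ^ 3) * w)" .
  have "real k * ?trA + (real m - 1) * ?trB > 0"
    using trace PQ unfolding A_def B_def sum_divide_distrib[symmetric]
    by (simp add: add_divide_distrib[symmetric])
  moreover have "l * ((real k - 1) / 2 * w) \<ge> 72 * (real k + real m) * M ^ 3 * w"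
  proof -
    have "144 * (real k + real m) * M ^ 3 * (1 / 2 * w) \<le> l * ((real k - 1) / 2 * w)"
      using curv l0 w_nonneg k(2) M by (intro mult_mono mult_right_mono) auto
    then show ?thesis by (simp add: algebra_simps)
  qed
  \<comment> \<open>The constant is \<open>9 * 5 + 9 * 3 = 72\<close>; as \<open>(k - 1) / 2\<close> may be \<open>1 / 2\<close>,
    the curvature \<open>l\<close> has to exceed twice as much.\<close>
  moreover have "9 * (real k + real m) * (5 * M ^ 3) * w + 9 * real m * (3 * M ^ 3) * w
      \<le> 72 * (real k + real m) * M ^ 3 * w"
  proof -
    have "0 \<le> real k * M ^ 3 * w" using M w_nonneg by auto
    then show ?thesis by (simp add: algebra_simps)
  qed
  ultimately show ?thesis using main by linarith
qed


section \<open>Warped metrics in stereographic charts\<close>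

definition stereo_deriv :: "real \<Rightarrow> real ^ 'k::finite \<Rightarrow> real ^ 'k \<Rightarrow> (real ^ 'k) \<times> real" where
  "stereo_deriv s y a = ((2 / (1 + y \<bullet> y)) *\<^sub>R a - (4 * (y \<bullet> a) / (1 + y \<bullet> y)\<^sup>2) *\<^sub>R y,
     s * (4 * (y \<bullet> a) / (1 + y \<bullet> y)\<^sup>2))"

lemma one_plus_inner_pos: "0 < 1 + y \<bullet> (y::'a::real_inner)"
  using inner_ge_zero[of y] by linarith

lemma one_plus_inner_nonzero: "1 + y \<bullet> (y::'a::real_inner) \<noteq> 0"
  using one_plus_inner_pos[of y] by simp

lemma has_derivative_inner_self: "((\<lambda>y::'a::real_inner. y \<bullet> y) has_derivative (\<lambda>h. 2 * (y \<bullet> h))) (at y)"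
  by (rule has_derivative_eq_rhs[OF has_derivative_inner[OF has_derivative_ident has_derivative_ident]])
     (simp add: inner_commute fun_eq_iff)

lemma has_derivative_stereo_inv: "(stereo_inv s has_derivative stereo_deriv s y) (at y)"
proof -
  let ?N = "1 + y \<bullet> y"
  have N: "?N \<noteq> 0" using one_plus_inner_pos[of y] by simp
  have 1: "((\<lambda>y::real^'a. 2 / (1 + y \<bullet> y)) has_derivative (\<lambda>h. - (4 * (y \<bullet> h) / ?N\<^sup>2))) (at y)"
    by (rule has_derivative_eq_rhs[OF has_derivative_divide[OF has_derivative_const
          has_derivative_add[OF has_derivative_const has_derivative_inner_self] N]])
       (simp add: fun_eq_iff power2_eq_square divide_inverse)
  have 2: "((\<lambda>y::real^'a. s * (y \<bullet> y - 1) / (y \<bullet> y + 1)) has_derivative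
      (\<lambda>h. s * (4 * (y \<bullet> h) / ?N\<^sup>2))) (at y)"
  proof -
    \<comment> \<open>The last coordinate is an affine function of the scaling factor of the first ones.\<close>
    have eq: "s * (y \<bullet> y - 1) / (y \<bullet> y + 1) = s * (1 - 2 / (1 + y \<bullet> y))" for y :: "real^'a"
      using one_plus_inner_pos[of y] by (simp add: field_simps)
    show ?thesis
      unfolding eq
      by (rule has_derivative_eq_rhs[OF has_derivative_mult_right[OF has_derivative_diff[OF has_derivative_const 1]]])
         simp
  qed
  show ?thesis
    unfolding stereo_inv_def[abs_def] stereo_deriv_def[abs_def]
    by (rule has_derivative_eq_rhs[OF has_derivative_Pair[OF has_derivative_scaleR[OF 1 has_derivative_ident] 2]])
       (simp add: fun_eq_iff)
qed

text \<open>
  Stereographic projection is conformal.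
\<close>

lemma stereo_deriv_inner:
  assumes "s \<in> {1, -1}"
  shows "stereo_deriv s y a \<bullet> stereo_deriv s y b = 4 / (1 + y \<bullet> y)\<^sup>2 * (a \<bullet> b)"
proof -
  define N where "N = 1 + y \<bullet> y"
  have N: "N > 0" unfolding N_def by (rule one_plus_inner_pos)
  have yy: "y \<bullet> y = N - 1" by (simp add: N_def)
  have s: "s * s = 1" using assms by auto
  have "stereo_deriv s y a \<bullet> stereo_deriv s y b
      = (2 / N) * (2 / N) * (a \<bullet> b) - 2 * ((2 / N) * (4 * (y \<bullet> a) * (y \<bullet> b) / N\<^sup>2))
        + (4 * (y \<bullet> a) / N\<^sup>2) * (4 * (y \<bullet> b) / N\<^sup>2) * (y \<bullet> y)
        + (s * s) * (4 * (y \<bullet> a) / N\<^sup>2) * (4 * (y \<bullet> b) / N\<^sup>2)"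
    unfolding stereo_deriv_def N_def[symmetric]
    by (simp add: inner_diff_left inner_diff_right inner_commute[of a y] algebra_simps)
  also have "\<dots> = 4 / N\<^sup>2 * (a \<bullet> b)"
    unfolding s yy using N by (simp add: field_simps power2_eq_square)
  finally show ?thesis by (simp add: N_def)
qed

lemma chart_deriv_eq: "chart_deriv s z a = (stereo_deriv s (fst z) (fst a), snd a)"
  unfolding chart_deriv_def frechet_derivative_at[OF has_derivative_stereo_inv, symmetric] ..

text \<open>
  Both warping factors are arbitrary here, since the perturbation changes the second one only.
\<close>

definition warped_tensor :: "('m::finite torus \<Rightarrow> real) \<Rightarrow> ('m torus \<Rightarrow> real) \<Rightarrow> ('k::finite, 'm) tensor2" where
  "warped_tensor u v = (\<lambda>(p, q) (a, x) (b, y). u q * round_metric p a b + v q * (x \<bullet> y))"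

lemma warped_metric_eq:
  "warped_metric n m \<epsilon> F = warped_tensor (\<lambda>q. \<epsilon>\<^sup>2 * (F q)\<^sup>2)
     (\<lambda>q. F q powr (- 2 * ((real n - real m) / (real m - 1))))"
  unfolding warped_metric_def warped_tensor_def by (simp add: inner_vec_def)

lemma pullback_warped_tensor:
  assumes "s \<in> {1, -1}"
  shows "pullback s (warped_tensor u v) z a b =
    in_coords u (snd z) * (4 / (1 + fst z \<bullet> fst z)\<^sup>2) * (fst a \<bullet> fst b) + in_coords v (snd z) * (snd a \<bullet> snd b)"
  unfolding pullback_def chart_deriv_eq chart_point_def warped_tensor_def
  by (simp add: round_metric_def stereo_deriv_inner[OF assms] in_coords_def)

lemma smooth_stereo_factor: "smooth (\<lambda>y::'a::euclidean_space. 4 / (1 + y \<bullet> y)\<^sup>2)"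
proof -
  have "smooth (\<lambda>y::'a. inverse (1 + y \<bullet> y))"
    by (intro smooth_inverse smooth_add smooth_const smooth_inner_self one_plus_inner_nonzero)
  then have "smooth (\<lambda>y::'a. 4 * (inverse (1 + y \<bullet> y) * inverse (1 + y \<bullet> y)))"
    by (intro smooth_mult smooth_const)
  then show ?thesis by (simp add: power2_eq_square divide_inverse)
qed

lemma smooth_pullback_warped_tensor:
  assumes "s \<in> {1, -1}" "smooth_torus u" "smooth_torus v"
  shows "smooth (\<lambda>z. pullback s (warped_tensor u v) z a b)"
  unfolding pullback_warped_tensor[OF assms(1)]
  using assms(2,3) unfolding smooth_torus_def
  by (intro smooth_add smooth_mult smooth_const smooth_fst_arg[OF smooth_stereo_factor] smooth_snd_arg)

lemma riemannian_metric_warped_tensor: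
  assumes "smooth_torus u" "smooth_torus v" "\<And>q. u q > 0" "\<And>q. v q > 0"
  shows "riemannian_metric (warped_tensor u v)"
proof -
  have "u q * (a \<bullet> a) + v q * (x \<bullet> x) > 0" if "(a, x) \<noteq> 0" for q and a :: "(real^'b) \<times> real" and x
  proof (cases "a = 0")
    case True
    then have "x \<noteq> 0" using that by (simp add: zero_prod_def)
    then show ?thesis using True assms(4)[of q] by simp
  next
    case False
    then show ?thesis using assms(3,4)[of q] by (intro add_pos_nonneg) auto
  qed
  then show ?thesis
    unfolding riemannian_metric_def
    by (auto simp: smooth_pullback_warped_tensor assms)
       (auto simp: warped_tensor_def round_metric_def inner_commute inner_add_left algebra_simps split: prod.splits)
qed

text \<open>
  The perturbation is affine in \<open>t\<close>, hence so is every iterated derivative, and the coefficients of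
  \<open>t\<close> are bounded on the compact set \<open>K\<close> because only finitely many derivatives are involved.
\<close>

lemma linear_perturbation_close:
  fixes u v h :: "'m::finite torus \<Rightarrow> real" and K :: "('k::finite, 'm) coord set"
  assumes u: "smooth_torus u" and v: "smooth_torus v" and h: "smooth_torus h" and K: "compact K" and d: "d > 0"
  shows "\<exists>t0>0. \<forall>t. 0 < t \<and> t < t0 \<and> riemannian_metric (warped_tensor u (\<lambda>q. v q + t * h q) :: ('k, 'm) tensor2) \<longrightarrow>
     (warped_tensor u (\<lambda>q. v q + t * h q)) \<in> close_metrics N K d (warped_tensor u v :: ('k, 'm) tensor2)"
proof -
  define D where "D b c = (\<lambda>z::('k, 'm) coord. in_coords h (snd z) * (snd b \<bullet> snd c))"
    for b c :: "('k, 'm) coord"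
  have D: "smooth (D b c)" for b c
    using h unfolding D_def smooth_torus_def by (intro smooth_mult smooth_const smooth_snd_arg)
  define L where "L = {vs :: ('k, 'm) coord list. set vs \<subseteq> Basis \<and> length vs \<le> N}"
  have "finite L" unfolding L_def by (rule finite_lists_length_le) simp
  then have "bounded (\<Union>(b, c, vs)\<in>Basis \<times> Basis \<times> L. iter_deriv vs (D b c) ` K)"
    by (intro bounded_UN)
       (auto intro!: compact_imp_bounded compact_continuous_image K smooth_continuous_on smooth_iter_deriv D)
  then obtain C where C: "C > 0"
    "\<And>x. x \<in> (\<Union>(b, c, vs)\<in>Basis \<times> Basis \<times> L. iter_deriv vs (D b c) ` K) \<Longrightarrow> \<bar>x\<bar> \<le> C"
    unfolding bounded_pos by (metis real_norm_def)
  have "\<bar>iter_deriv vs (\<lambda>y. pullback s (warped_tensor u (\<lambda>q. v q + t * h q)) y b c) z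
        - iter_deriv vs (\<lambda>y. pullback s (warped_tensor u v) y b c) z\<bar> < d"
    if t: "0 < t" "t < d / C" and s: "s \<in> {1, -1}" and z: "z \<in> K" and bc: "b \<in> Basis" "c \<in> Basis"
      and vs: "set vs \<subseteq> Basis \<and> length vs \<le> N" for t s z b c vs
  proof -
    have "(\<lambda>y. pullback s (warped_tensor u (\<lambda>q. v q + t * h q)) y b c)
        = (\<lambda>y. pullback s (warped_tensor u v) y b c + t * D b c y)"
      by (rule ext) (simp add: pullback_warped_tensor[OF s] D_def in_coords_def algebra_simps)
    then have "iter_deriv vs (\<lambda>y. pullback s (warped_tensor u (\<lambda>q. v q + t * h q)) y b c) z
        - iter_deriv vs (\<lambda>y. pullback s (warped_tensor u v) y b c) z = t * iter_deriv vs (D b c) z"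
      by (simp add: iter_deriv_add_mult[OF smooth_pullback_warped_tensor[OF s u v] D])
    moreover have "\<bar>iter_deriv vs (D b c) z\<bar> \<le> C"
      by (rule C(2)) (use z bc vs in \<open>auto simp: L_def\<close>)
    then have "\<bar>t * iter_deriv vs (D b c) z\<bar> \<le> t * C"
      using t(1) by (simp add: abs_mult mult_left_mono)
    moreover have "t * C < d" using t(2) C(1) by (simp add: pos_less_divide_eq)
    ultimately show ?thesis by linarith
  qed
  then show ?thesis
    unfolding close_metrics_def using C(1) d
    by (intro exI[of _ "d / C"]) auto
qed

text \<open>
  In a stereographic chart \<open>\<epsilon>\<^sup>2\<close> times the round metric is \<open>exp (2 * log_stereo_factor \<epsilon> y) * dy\<^sup>2\<close>.
\<close>

definition log_stereo_factor :: "real \<Rightarrow> 'a::real_inner \<Rightarrow> real" where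
  "log_stereo_factor \<epsilon> y = ln (2 * \<epsilon> / (1 + y \<bullet> y))"

lemma exp_log_stereo_factor:
  "\<epsilon> > 0 \<Longrightarrow> exp (2 * log_stereo_factor \<epsilon> y) = \<epsilon>\<^sup>2 * (4 / (1 + y \<bullet> y)\<^sup>2)"
  using one_plus_inner_pos[of y]
  by (simp add: log_stereo_factor_def exp_double power_divide power_mult_distrib)

lemma has_derivative_log_stereo_factor:
  assumes "\<epsilon> > 0"
  shows "(log_stereo_factor \<epsilon> has_derivative (\<lambda>h. (- (2 / (1 + y \<bullet> y)) *\<^sub>R y) \<bullet> h)) (at y)"
proof -
  have eq: "log_stereo_factor \<epsilon> = (\<lambda>y::'a. ln (2 * \<epsilon>) - ln (1 + y \<bullet> y))"
    using assms by (simp add: log_stereo_factor_def fun_eq_iff ln_div one_plus_inner_nonzero)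
  show ?thesis
    unfolding eq using one_plus_inner_pos[of y]
    by (auto intro!: derivative_eq_intros simp: fun_eq_iff inner_commute divide_inverse)
qed

lemma has_derivative_grad_log_stereo_factor:
  fixes y :: "'a::real_inner"
  shows "((\<lambda>y. - (2 / (1 + y \<bullet> y)) *\<^sub>R y) has_derivative
     (\<lambda>h. (4 * (y \<bullet> h) / (1 + y \<bullet> y)\<^sup>2) *\<^sub>R y - (2 / (1 + y \<bullet> y)) *\<^sub>R h)) (at y)"
proof -
  let ?N = "1 + y \<bullet> y"
  have N: "?N \<noteq> 0" using one_plus_inner_pos[of y] by simp
  have 1: "((\<lambda>y::'a. - (2 / (1 + y \<bullet> y))) has_derivative (\<lambda>h. 4 * (y \<bullet> h) / ?N\<^sup>2)) (at y)"
    by (rule has_derivative_eq_rhs[OF has_derivative_minus[OF has_derivative_divide[OF has_derivative_const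
          has_derivative_add[OF has_derivative_const has_derivative_inner_self] N]]])
       (simp add: fun_eq_iff power2_eq_square divide_inverse)
  show ?thesis
    by (rule has_derivative_eq_rhs[OF has_derivative_scaleR[OF 1 has_derivative_ident]])
       (simp add: fun_eq_iff)
qed

text \<open>
  The round sphere of radius \<open>\<epsilon>\<close> has constant curvature \<open>1 / \<epsilon>\<^sup>2\<close>, so \<open>conformal_form\<close> is the metric
  divided by \<open>2 * \<epsilon>\<^sup>2\<close>.
\<close>

lemma conformal_form_log_stereo_factor:
  fixes y :: "'a::real_inner"
  assumes "\<epsilon> > 0"
  shows "conformal_form (- (2 / (1 + y \<bullet> y)) *\<^sub>R y)
      (\<lambda>h. (4 * (y \<bullet> h) / (1 + y \<bullet> y)\<^sup>2) *\<^sub>R y - (2 / (1 + y \<bullet> y)) *\<^sub>R h) a b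
    = exp (2 * log_stereo_factor \<epsilon> y) / (2 * \<epsilon>\<^sup>2) * (a \<bullet> b)"
proof -
  define N where "N = 1 + y \<bullet> y"
  have N: "N > 0" unfolding N_def by (rule one_plus_inner_pos)
  have yy: "y \<bullet> y = N - 1" by (simp add: N_def)
  have "conformal_form (- (2 / N) *\<^sub>R y) (\<lambda>h. (4 * (y \<bullet> h) / N\<^sup>2) *\<^sub>R y - (2 / N) *\<^sub>R h) a b
      = 2 / N * (a \<bullet> b) - (2 / N) * (2 / N) * (N - 1) / 2 * (a \<bullet> b)"
    unfolding conformal_form_def by (simp add: inner_diff_left yy power2_eq_square)
  also have "\<dots> = 4 / N\<^sup>2 / 2 * (a \<bullet> b)"
    using N by (simp add: field_simps power2_eq_square)
  finally show ?thesis
    using assms unfolding exp_log_stereo_factor[OF assms] N_def by simp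
qed


section \<open>Perturbation at the critical points\<close>

text \<open>
  The curvature sum of a frame adapted to the base, for \<open>\<psi> = - \<beta> * \<phi> + r\<close>. The exponent \<open>\<beta> = k / (m - 1)\<close>
  is chosen such that the Laplacians of \<open>\<phi>\<close> cancel. The products of the gradients of \<open>\<phi>\<close> and \<open>r\<close> cancel as
  well, so the correction \<open>r\<close> enters on its own. For \<open>r = 0\<close> a multiple of \<open>|grad \<phi>|\<^sup>2\<close> remains, whose
  coefficient is positive if \<open>(m - 2) * \<beta> > 2\<close>.
\<close>

lemma trace_curvature_eq:
  fixes g r :: "'x::euclidean_space" and H \<rho> :: "'x \<Rightarrow> 'x" and k \<beta> :: real
  assumes \<beta>: "(real DIM('x) - 1) * \<beta> = k"
  defines "q \<equiv> - \<beta> *\<^sub>R g + r" and "N \<equiv> \<lambda>h. - \<beta> *\<^sub>R H h + \<rho> h"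
  shows "k * (\<Sum>b\<in>Basis. mixed_form g H q b b) + (real DIM('x) - 1) * (\<Sum>b\<in>Basis. conformal_form q N b b)
    = k * ((real DIM('x) - 2) * \<beta> / 2 - 1) * (g \<bullet> g)
      - (real DIM('x) - 1) * ((\<Sum>b\<in>Basis. \<rho> b \<bullet> b) + (real DIM('x) - 2) / 2 * (r \<bullet> r))"
proof -
  let ?m = "real DIM('x)"
  have ib: "(\<Sum>b\<in>Basis. (u \<bullet> b) * (v \<bullet> b)) = u \<bullet> v" for u v :: 'x
    by (simp add: euclidean_inner[symmetric])
  have one: "(\<Sum>b\<in>(Basis::'x set). c * (b \<bullet> b)) = c * ?m" for c
    by simp
  have mix: "(\<Sum>b\<in>Basis. mixed_form g H q b b) = - (\<Sum>b\<in>Basis. H b \<bullet> b) - g \<bullet> g - (?m - 2) * (q \<bullet> g)"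
    unfolding mixed_form_def sum_subtractf sum.distrib ib one by (simp add: sum_negf algebra_simps)
  have conf: "(\<Sum>b\<in>Basis. conformal_form q N b b) = - (\<Sum>b\<in>Basis. N b \<bullet> b) - (?m - 2) / 2 * (q \<bullet> q)"
    unfolding conformal_form_def sum_subtractf sum.distrib ib one by (simp add: sum_negf field_simps)
  have N: "(\<Sum>b\<in>Basis. N b \<bullet> b) = - \<beta> * (\<Sum>b\<in>Basis. H b \<bullet> b) + (\<Sum>b\<in>Basis. \<rho> b \<bullet> b)"
    unfolding N_def by (simp add: inner_diff_left sum_subtractf sum_distrib_left[symmetric])
  have qg: "q \<bullet> g = - \<beta> * (g \<bullet> g) + r \<bullet> g"
    unfolding q_def by (simp add: inner_diff_left)
  have qq: "q \<bullet> q = \<beta> * \<beta> * (g \<bullet> g) - 2 * \<beta> * (r \<bullet> g) + r \<bullet> r"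
    unfolding q_def by (simp add: inner_diff_left inner_diff_right inner_commute[of g r] algebra_simps)
  show ?thesis
    unfolding mix conf N qg qq \<beta>[symmetric] by (simp add: field_simps)
qed

text \<open>
  If \<open>g\<close> is positive on the zero set of \<open>f \<ge> 0\<close>, then \<open>M * f + g\<close> is bounded below by some \<open>\<mu> > 0\<close> for
  large \<open>M\<close> by compactness. For \<open>t \<le> 1 / M\<close> this yields \<open>f + t * g \<ge> t * \<mu>\<close>, which dominates a term of
  order \<open>t\<^sup>2\<close>.
\<close>

lemma perturb_pos:
  fixes f g :: "'a::metric_space \<Rightarrow> real"
  assumes K: "compact K" and f: "continuous_on K f" "\<And>x. x \<in> K \<Longrightarrow> f x \<ge> 0"
    and g: "continuous_on K g" "\<And>x. x \<in> K \<Longrightarrow> f x = 0 \<Longrightarrow> g x > 0" and H: "H \<ge> 0"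
  shows "\<exists>t0>0. \<forall>t x. 0 < t \<and> t < t0 \<and> x \<in> K \<longrightarrow> f x + t * g x - t\<^sup>2 * H > 0"
proof (cases "K = {}")
  case False
  have "\<exists>M>0. \<forall>x\<in>K. M * f x + g x > 0"
  proof -
    define S where "S = {x \<in> K. g x \<le> 0}"
    have S: "compact S"
    proof -
      have "S = K \<inter> g -` {..0}" unfolding S_def by auto
      then show ?thesis
        using continuous_closed_preimage[OF g(1) compact_imp_closed[OF K] closed_atMost]
          compact_Int_closed[OF K] by (metis Int_absorb Int_assoc)
    qed
    show ?thesis
    proof (cases "S = {}")
      case True
      then have "\<forall>x\<in>K. g x > 0" unfolding S_def by force
      then show ?thesis using f(2) by (intro exI[of _ 1]) (auto intro: add_nonneg_pos)
    next
      case False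
      have SK: "S \<subseteq> K" unfolding S_def by blast
      obtain a where a: "a \<in> S" "\<And>x. x \<in> S \<Longrightarrow> f a \<le> f x"
        using continuous_attains_inf[OF S False continuous_on_subset[OF f(1) SK]] by blast
      obtain b where b: "b \<in> S" "\<And>x. x \<in> S \<Longrightarrow> g b \<le> g x"
        using continuous_attains_inf[OF S False continuous_on_subset[OF g(1) SK]] by blast
      have fa: "f a > 0" using a(1) f(2)[of a] g(2)[of a] unfolding S_def by force
      have gb: "g b \<le> 0" using b(1) unfolding S_def by blast
      \<comment> \<open>Chosen such that \<open>M * f + g \<ge> 1\<close> where \<open>g \<le> 0\<close>.\<close>
      define M where "M = (1 - g b) / f a"
      have M: "M > 0" unfolding M_def using fa gb by simp
      have "M * f x + g x > 0" if x: "x \<in> K" for x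
      proof (cases "x \<in> S")
        case True
        have "1 - g b = M * f a" unfolding M_def using fa by simp
        also have "\<dots> \<le> M * f x" using a(2)[OF True] M by simp
        finally show ?thesis using b(2)[OF True] by linarith
      next
        case False
        then have "g x > 0" using x unfolding S_def by auto
        then show ?thesis using M f(2)[OF x] by (intro add_nonneg_pos) auto
      qed
      then show ?thesis using M by blast
    qed
  qed
  then obtain M where M: "M > 0" "\<And>x. x \<in> K \<Longrightarrow> M * f x + g x > 0" by blast
  have "continuous_on K (\<lambda>x. M * f x + g x)" by (intro continuous_intros f g)
  then obtain c where c: "c \<in> K" "\<And>x. x \<in> K \<Longrightarrow> M * f c + g c \<le> M * f x + g x"
    using continuous_attains_inf[OF K False] by blast
  define \<mu> where "\<mu> = M * f c + g c"
  have \<mu>: "\<mu> > 0" unfolding \<mu>_def by (rule M(2)[OF c(1)])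
  have "f x + t * g x - t\<^sup>2 * H > 0" if t: "0 < t" "t < min (1 / M) (\<mu> / (H + 1))" and x: "x \<in> K" for t x
  proof -
    have "t * M \<le> 1" using t M(1) by (simp add: pos_less_divide_eq)
    then have "t * M * f x \<le> f x" using mult_right_mono[of "t * M" 1 "f x"] f(2)[OF x] by simp
    moreover have "t * (M * f x + g x) \<ge> t * \<mu>" using t(1) c(2)[OF x] by (simp add: \<mu>_def)
    moreover have "t * (t * H) < t * \<mu>"
    proof -
      have "t * (H + 1) < \<mu>" using t H by (simp add: pos_less_divide_eq)
      then have "t * H < \<mu>" using t(1) by (simp add: algebra_simps)
      then show ?thesis using t(1) by simp
    qed
    ultimately show ?thesis by (simp add: algebra_simps power2_eq_square)
  qed
  moreover have "min (1 / M) (\<mu> / (H + 1)) > 0" using M(1) \<mu> H by simp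
  ultimately show ?thesis by blast
qed (auto intro: exI[of _ 1])

text \<open>
  Gradient and Hessian of \<open>ln (1 - t * \<theta>) / 2\<close>, by which \<open>\<psi>\<close> changes if the torus part of the metric is
  multiplied by \<open>1 - t * \<theta>\<close>.
\<close>

definition log_factor_grad :: "real \<Rightarrow> ('a::euclidean_space \<Rightarrow> real) \<Rightarrow> 'a \<Rightarrow> 'a" where
  "log_factor_grad t \<theta> x = - (t / (2 * (1 - t * \<theta> x))) *\<^sub>R grad \<theta> x"

definition log_factor_hess :: "real \<Rightarrow> ('a::euclidean_space \<Rightarrow> real) \<Rightarrow> 'a \<Rightarrow> 'a \<Rightarrow> 'a" where
  "log_factor_hess t \<theta> x h = - (t / (2 * (1 - t * \<theta> x))) *\<^sub>R hess \<theta> x h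
     - (t\<^sup>2 * (grad \<theta> x \<bullet> h) / (2 * (1 - t * \<theta> x)\<^sup>2)) *\<^sub>R grad \<theta> x"

lemma has_derivative_log_factor:
  assumes "smooth \<theta>" "t * \<theta> x < 1"
  shows "((\<lambda>x. ln (1 - t * \<theta> x) / 2) has_derivative (\<lambda>h. log_factor_grad t \<theta> x \<bullet> h)) (at x)"
  unfolding log_factor_grad_def using assms(2)
  by (auto intro!: derivative_eq_intros has_derivative_grad assms(1) simp: fun_eq_iff field_simps)

lemma has_derivative_log_factor_grad:
  assumes "smooth \<theta>" "t * \<theta> x < 1"
  shows "(log_factor_grad t \<theta> has_derivative log_factor_hess t \<theta> x) (at x)"
proof -
  let ?u = "1 - t * \<theta> x"
  define w where "w = ?u"
  have w: "w \<noteq> 0" using assms(2) by (simp add: w_def)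
  have quot: "t / (2 * v) = t / 2 * inverse v" for v
    by (cases "v = 0") (simp_all add: field_simps)
  have alg: "- (t / 2 * - (inverse w * (- (t * c)) * inverse w)) = - (t\<^sup>2 * c / (2 * w\<^sup>2))" for c
    using w by (simp add: field_simps power2_eq_square)
  have "((\<lambda>x. 1 - t * \<theta> x) has_derivative (\<lambda>h. - (t * (grad \<theta> x \<bullet> h)))) (at x)"
    by (rule has_derivative_eq_rhs[OF has_derivative_diff[OF has_derivative_const
          has_derivative_mult_right[OF has_derivative_grad[OF assms(1)]]]]) simp
  then have "((\<lambda>x. - (t / 2 * inverse (1 - t * \<theta> x))) has_derivative
      (\<lambda>h. - (t / 2 * - (inverse ?u * (- (t * (grad \<theta> x \<bullet> h))) * inverse ?u)))) (at x)"
    using w unfolding w_def by (intro has_derivative_minus has_derivative_mult_right Deriv.has_derivative_inverse)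
  then have 1: "((\<lambda>x. - (t / (2 * (1 - t * \<theta> x)))) has_derivative
      (\<lambda>h. - (t\<^sup>2 * (grad \<theta> x \<bullet> h) / (2 * ?u\<^sup>2)))) (at x)"
    unfolding alg[unfolded w_def] quot .
  show ?thesis
    unfolding log_factor_grad_def[abs_def] log_factor_hess_def[abs_def]
    by (rule has_derivative_eq_rhs[OF has_derivative_scaleR[OF 1 has_derivative_hess[OF assms(1)]]]) simp
qed

lemma trace_log_factor_hess:
  assumes "t * \<theta> x < 1"
  shows "(\<Sum>b\<in>Basis. log_factor_hess t \<theta> x b \<bullet> b) =
    - (t / (2 * (1 - t * \<theta> x))) * laplacian \<theta> x - t\<^sup>2 / (2 * (1 - t * \<theta> x)\<^sup>2) * (grad \<theta> x \<bullet> grad \<theta> x)"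
proof -
  have "log_factor_hess t \<theta> x b \<bullet> b = - (t / (2 * (1 - t * \<theta> x))) * (hess \<theta> x b \<bullet> b)
     - t\<^sup>2 / (2 * (1 - t * \<theta> x)\<^sup>2) * ((grad \<theta> x \<bullet> b) * (grad \<theta> x \<bullet> b))" for b
    unfolding log_factor_hess_def by (simp add: inner_diff_left)
  then show ?thesis
    by (simp only: sum_subtractf sum_distrib_left[symmetric] trace_hess euclidean_inner[symmetric])
qed

lemma norm_log_factor_le:
  assumes t: "0 \<le> t" "t * T \<le> 1 / 2" and T: "\<bar>\<theta> x\<bar> \<le> T" "norm (grad \<theta> x) \<le> T" "\<And>h. norm (hess \<theta> x h) \<le> T * norm h"
  shows "t * \<theta> x \<le> 1 / 2" "norm (log_factor_grad t \<theta> x) \<le> 1"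
    "norm (log_factor_hess t \<theta> x h) \<le> norm h"
proof -
  let ?u = "1 - t * \<theta> x"
  have T0: "0 \<le> T" using T(1) by linarith
  have "t * \<theta> x \<le> t * T" using t(1) T(1) by (intro mult_left_mono) auto
  then show th: "t * \<theta> x \<le> 1 / 2" using t(2) by linarith
  have u: "1 \<le> 2 * ?u" using th by simp
  have tu: "\<bar>t / (2 * ?u)\<bar> \<le> t" "0 \<le> t / (2 * ?u)"
  proof -
    show "0 \<le> t / (2 * ?u)" using u t(1) by simp
    moreover have "t / (2 * ?u) \<le> t / 1" using u t(1) by (intro divide_left_mono) auto
    ultimately show "\<bar>t / (2 * ?u)\<bar> \<le> t" by (simp only: abs_of_nonneg div_by_1)
  qed
  have "norm (log_factor_grad t \<theta> x) \<le> t * T"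
    unfolding log_factor_grad_def using mult_mono[OF tu(1) T(2)] t(1) by simp
  then show "norm (log_factor_grad t \<theta> x) \<le> 1" using t(2) by linarith
  have 1: "norm ((t / (2 * ?u)) *\<^sub>R hess \<theta> x h) \<le> t * (T * norm h)"
    using mult_mono[OF tu(1) T(3)[of h]] t(1) by simp
  have "\<bar>grad \<theta> x \<bullet> h\<bar> \<le> T * norm h"
    using Cauchy_Schwarz_ineq2[of "grad \<theta> x" h] T(2) by (meson mult_right_mono norm_ge_zero order_trans)
  then have a1: "\<bar>grad \<theta> x \<bullet> h\<bar> * norm (grad \<theta> x) \<le> (T * norm h) * T"
    using T(2) T0 by (intro mult_mono) auto
  have a2: "(t / (2 * ?u))\<^sup>2 \<le> t\<^sup>2"
    using tu(2) order_trans[OF abs_ge_self tu(1)] by (intro power_mono)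
  have "(2 * (t / (2 * ?u))\<^sup>2) * (\<bar>grad \<theta> x \<bullet> h\<bar> * norm (grad \<theta> x)) \<le> (2 * t\<^sup>2) * ((T * norm h) * T)"
    by (rule mult_mono[OF mult_left_mono[OF a2] a1]) auto
  moreover have eq: "t\<^sup>2 * (grad \<theta> x \<bullet> h) / (2 * v\<^sup>2) = (2 * (t / (2 * v))\<^sup>2) * (grad \<theta> x \<bullet> h)" for v
    by (simp add: power_divide power_mult_distrib)
  have "norm ((t\<^sup>2 * (grad \<theta> x \<bullet> h) / (2 * ?u\<^sup>2)) *\<^sub>R grad \<theta> x)
      = (2 * (t / (2 * ?u))\<^sup>2) * (\<bar>grad \<theta> x \<bullet> h\<bar> * norm (grad \<theta> x))"
    unfolding eq by (simp add: abs_mult)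
  ultimately have 2: "norm ((t\<^sup>2 * (grad \<theta> x \<bullet> h) / (2 * ?u\<^sup>2)) *\<^sub>R grad \<theta> x) \<le> 2 * (t * T)\<^sup>2 * norm h"
    by (simp add: power2_eq_square algebra_simps)
  have "(t * T)\<^sup>2 \<le> (1 / 2)\<^sup>2" using t T0 by (intro power_mono) auto
  then have "2 * (t * T)\<^sup>2 * norm h \<le> 1 / 2 * norm h" by (intro mult_right_mono) (auto simp: power2_eq_square)
  moreover have "t * (T * norm h) \<le> 1 / 2 * norm h"
    using mult_right_mono[OF t(2) norm_ge_zero[of h]] by (simp add: mult.assoc)
  moreover have "norm (log_factor_hess t \<theta> x h) \<le> norm ((t / (2 * ?u)) *\<^sub>R hess \<theta> x h)
      + norm ((t\<^sup>2 * (grad \<theta> x \<bullet> h) / (2 * ?u\<^sup>2)) *\<^sub>R grad \<theta> x)"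
    unfolding log_factor_hess_def
    using norm_triangle_ineq4[of "- ((t / (2 * ?u)) *\<^sub>R hess \<theta> x h)"
        "(t\<^sup>2 * (grad \<theta> x \<bullet> h) / (2 * ?u\<^sup>2)) *\<^sub>R grad \<theta> x"]
    by (simp only: norm_minus_cancel scaleR_minus_left)
  ultimately show "norm (log_factor_hess t \<theta> x h) \<le> norm h" using 1 2 by linarith
qed

text \<open>
  Multiplying the torus part by \<open>1 - t * \<theta>\<close> changes the curvature sum of adapted frames to first order by a
  positive multiple of \<open>t\<close> times the Laplacian of \<open>\<theta>\<close>. That sum vanishes for \<open>t = 0\<close> exactly at the critical
  points of \<open>\<phi>\<close>, so it becomes positive everywhere if \<open>\<theta>\<close> has positive Laplacian there.
\<close>

lemma exists_perturbation:
  fixes \<phi> \<theta> :: "real ^ 'm::finite \<Rightarrow> real" and k \<beta> :: real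
  defines "m \<equiv> real CARD('m)"
  assumes \<phi>: "smooth \<phi>" "lattice_periodic \<phi>" and \<theta>: "smooth \<theta>" "lattice_periodic \<theta>" "\<And>x. \<theta> x \<ge> 0"
    and crit: "\<And>x. grad \<phi> x = 0 \<Longrightarrow> laplacian \<theta> x > 0"
    and m: "m > 1" and \<beta>: "(m - 1) * \<beta> = k" "(m - 2) * \<beta> > 2" and k: "k > 0"
  shows "\<exists>t0>0. \<forall>t x. 0 < t \<and> t < t0 \<longrightarrow>
      t * \<theta> x \<le> 1 / 2 \<and> norm (log_factor_grad t \<theta> x) \<le> 1 \<and> (\<forall>h. norm (log_factor_hess t \<theta> x h) \<le> norm h) \<and>
      k * (\<Sum>b\<in>Basis. mixed_form (grad \<phi> x) (hess \<phi> x) (- \<beta> *\<^sub>R grad \<phi> x + log_factor_grad t \<theta> x) b b)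
      + (m - 1) * (\<Sum>b\<in>Basis. conformal_form (- \<beta> *\<^sub>R grad \<phi> x + log_factor_grad t \<theta> x)
          (\<lambda>h. - \<beta> *\<^sub>R hess \<phi> x h + log_factor_hess t \<theta> x h) b b) > 0"
proof -
  obtain C where C: "\<And>vs x. set vs \<subseteq> Basis \<Longrightarrow> length vs \<le> 2 \<Longrightarrow> \<bar>iter_deriv vs \<theta> x\<bar> \<le> C"
    using lattice_periodic_bounded_finite[OF finite_iter_deriv_lists, of 2 "\<lambda>vs. iter_deriv vs \<theta>"]
      smooth_iter_deriv[OF \<theta>(1)] lattice_periodic_iter_deriv[OF \<theta>(1,2)] by blast
  define T where "T = m\<^sup>2 * C + 1"
  have C0: "\<bar>\<theta> x\<bar> \<le> C" for x using C[of "[]" x] by simp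
  have Cpos: "C \<ge> 0" using C0[of 0] by linarith
  have T: "\<bar>\<theta> x\<bar> \<le> T" "norm (grad \<theta> x) \<le> T" "norm (hess \<theta> x h) \<le> T * norm h" for x h
  proof -
    have mC: "C \<le> m * C" "m * C \<le> m\<^sup>2 * C"
      using mult_right_mono[of 1 m C] mult_left_mono[of C "m * C" m] m Cpos
      by (simp_all add: power2_eq_square mult.assoc)
    show "\<bar>\<theta> x\<bar> \<le> T" using C0[of x] mC unfolding T_def by linarith
    have "norm (grad \<theta> x) \<le> m * C"
      using norm_grad_le[of \<theta> x C] C[of "[_]" x] unfolding m_def by simp
    then show "norm (grad \<theta> x) \<le> T" using mC unfolding T_def by linarith
    have "norm (hess \<theta> x h) \<le> m\<^sup>2 * C * norm h"
      using norm_hess_le[OF \<theta>(1), of x C h] C[of "[_, _]" x] unfolding m_def by simp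
    then show "norm (hess \<theta> x h) \<le> T * norm h"
      unfolding T_def by (simp add: distrib_right add_increasing2)
  qed
  have T1: "T \<ge> 1" using Cpos unfolding T_def by simp
  define c where "c = k * ((m - 2) * \<beta> / 2 - 1)"
  have c: "c > 0" unfolding c_def using k \<beta>(2) by simp
  \<comment> \<open>After division by \<open>(m - 1) / (2 * (1 - t * \<theta>))\<close> the expression to be bounded is at
    least \<open>f + t * laplacian \<theta>\<close> up to a term of order \<open>t\<^sup>2\<close>.\<close>
  define f where "f x = c / (m - 1) * (grad \<phi> x \<bullet> grad \<phi> x)" for x
  have f0: "f x \<ge> 0" for x unfolding f_def using c m by simp
  have fz: "f x = 0 \<Longrightarrow> grad \<phi> x = 0" for x unfolding f_def using c m by simp
  obtain t1 where t1: "t1 > 0"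
    "\<And>t x. 0 < t \<Longrightarrow> t < t1 \<Longrightarrow> x \<in> cbox 0 (\<chi> i. 1) \<Longrightarrow> f x + t * laplacian \<theta> x - t\<^sup>2 * (m * T\<^sup>2) > 0"
  proof -
    have "\<exists>t0>0. \<forall>t x. 0 < t \<and> t < t0 \<and> x \<in> cbox 0 (\<chi> i. 1) \<longrightarrow>
        f x + t * laplacian \<theta> x - t\<^sup>2 * (m * T\<^sup>2) > 0"
    proof (rule perturb_pos)
      show "continuous_on (cbox 0 (\<chi> i. 1)) f"
        unfolding f_def by (intro continuous_intros smooth_continuous_on_grad \<phi>)
      show "continuous_on (cbox 0 (\<chi> i. 1)) (laplacian \<theta>)"
        by (intro smooth_continuous_on smooth_laplacian \<theta>)
    qed (use f0 fz crit m in auto)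
    then show ?thesis using that by blast
  qed
  have per: "lattice_periodic f"
    unfolding lattice_periodic_def
  proof (intro allI impI)
    fix x y :: "real ^ 'm" assume "lattice_rel x y"
    then have "grad \<phi> x = grad \<phi> y"
      using lattice_periodic_grad[OF \<phi>] unfolding lattice_periodic_def by blast
    then show "f x = f y" by (simp add: f_def)
  qed
  have f_pos: "f x + t * laplacian \<theta> x - t\<^sup>2 * (m * T\<^sup>2) > 0" if t: "0 < t" "t < t1" for t x
  proof -
    obtain y where y: "y \<in> cbox 0 (\<chi> i. 1)" "lattice_rel x y" by (rule lattice_rel_cube)
    have "f x = f y" "laplacian \<theta> x = laplacian \<theta> y"
      using y(2) per lattice_periodic_laplacian[OF \<theta>(1,2)] unfolding lattice_periodic_def by blast+
    then show ?thesis using t1(2)[OF t y(1)] by simp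
  qed
  have pos: "k * (\<Sum>b\<in>Basis. mixed_form (grad \<phi> x) (hess \<phi> x) (- \<beta> *\<^sub>R grad \<phi> x + log_factor_grad t \<theta> x) b b)
      + (m - 1) * (\<Sum>b\<in>Basis. conformal_form (- \<beta> *\<^sub>R grad \<phi> x + log_factor_grad t \<theta> x)
          (\<lambda>h. - \<beta> *\<^sub>R hess \<phi> x h + log_factor_hess t \<theta> x h) b b) > 0"
    (is "?E > 0") if t: "0 < t" "t < t1" and half: "t * \<theta> x \<le> 1 / 2" for t x
  proof -
    define u where "u = 1 - t * \<theta> x"
    have u: "1 / 2 \<le> u" "u \<le> 1" unfolding u_def using half t \<theta>(3)[of x] by auto
    define G where "G = grad \<theta> x \<bullet> grad \<theta> x"
    define a where "a = grad \<phi> x \<bullet> grad \<phi> x"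
    define L where "L = laplacian \<theta> x"
    have G: "0 \<le> G" "G \<le> T\<^sup>2"
      unfolding G_def using T(2)[of x] by (auto simp: dot_square_norm intro!: power_mono)
    have a: "a \<ge> 0" unfolding a_def by simp
    have lf: "log_factor_grad t \<theta> x \<bullet> log_factor_grad t \<theta> x = t\<^sup>2 / (4 * u\<^sup>2) * G"
      unfolding log_factor_grad_def u_def[symmetric] G_def by (simp add: power2_eq_square)
    have "?E = c * a - (m - 1) * ((- (t / (2 * u)) * L - t\<^sup>2 / (2 * u\<^sup>2) * G)
        + (m - 2) / 2 * (t\<^sup>2 / (4 * u\<^sup>2) * G))"
      using trace_curvature_eq[of \<beta> k "grad \<phi> x" "hess \<phi> x" "log_factor_grad t \<theta> x" "log_factor_hess t \<theta> x"]
        trace_log_factor_hess[of t \<theta> x] half \<beta>(1)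
      unfolding m_def[symmetric] c_def lf by (simp add: m_def[symmetric] u_def[symmetric] L_def G_def a_def)
    also have "\<dots> = (m - 1) / (2 * u) * (2 * u * (c / (m - 1) * a) + t * L + (t\<^sup>2 * G / u) * (1 - (m - 2) / 4))"
      using u m by (simp add: field_simps power2_eq_square)
    finally have E: "?E = (m - 1) / (2 * u) * (2 * u * (c / (m - 1) * a) + t * L + (t\<^sup>2 * G / u) * (1 - (m - 2) / 4))" .
    have "2 * u * (c / (m - 1) * a) \<ge> 1 * (c / (m - 1) * a)"
      using u c m a by (intro mult_right_mono) auto
    moreover have "(t\<^sup>2 * G / u) * (1 - (m - 2) / 4) \<ge> - (t\<^sup>2 * (m * T\<^sup>2))"
    proof -
      have "t\<^sup>2 * G / u \<le> t\<^sup>2 * T\<^sup>2 / (1 / 2)"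
        using u G by (intro frac_le mult_left_mono) auto
      then have "(t\<^sup>2 * G / u) * (m / 4) \<le> (2 * t\<^sup>2 * T\<^sup>2) * (m / 4)"
        using m by (intro mult_right_mono) auto
      moreover have "(2 * t\<^sup>2 * T\<^sup>2) * (m / 4) \<le> t\<^sup>2 * (m * T\<^sup>2)"
        using m by simp
      moreover have "(t\<^sup>2 * G / u) * (1 - (m - 2) / 4) \<ge> (t\<^sup>2 * G / u) * - (m / 4)"
        using u G by (intro mult_left_mono) (auto simp: field_simps)
      ultimately show ?thesis by linarith
    qed
    ultimately have "0 < 2 * u * (c / (m - 1) * a) + t * L + (t\<^sup>2 * G / u) * (1 - (m - 2) / 4)"
      using f_pos[OF t, of x] unfolding f_def a_def L_def by linarith
    then show ?thesis unfolding E using u m by (intro mult_pos_pos) auto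
  qed
  define t0 where "t0 = min t1 (1 / (2 * T))"
  have "t0 > 0" unfolding t0_def using t1(1) T1 by simp
  moreover have "t * T \<le> 1 / 2" if "t < t0" for t
    using that T1 unfolding t0_def by (simp add: field_simps)
  ultimately show ?thesis
    using pos norm_log_factor_le[OF _ _ T]
    by (intro exI[of _ t0]) (auto simp: t0_def less_imp_le)
qed


section \<open>Positivity of the intermediate curvature\<close>

text \<open>
  In both stereographic charts the perturbed metric is doubly warped. The number to the fourth power in
  \<open>small\<close> bounds the first two derivatives of \<open>\<phi>\<close> and \<open>\<psi>\<close> as well as \<open>exp (2 * \<phi>)\<close> and \<open>exp (- 2 * \<psi>)\<close> in terms
  of the \<open>C\<^sup>2\<close> norm of \<open>\<phi> = ln F\<close>; the perturbation adds at most constants.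
\<close>

lemma perturbed_metric_positive:
  fixes F :: "'m::finite torus \<Rightarrow> real" and \<epsilon> \<beta> t :: real and k m :: nat
  defines "\<phi> \<equiv> \<lambda>x. ln (in_coords F x)" and "\<theta> \<equiv> grad_sq (in_coords F)"
  defines "g \<equiv> warped_tensor (\<lambda>q. \<epsilon>\<^sup>2 * (F q)\<^sup>2)
      (\<lambda>q. F q powr (- 2 * \<beta>) + t * - (F q powr (- 2 * \<beta>) * \<theta> (rep_torus q))) :: ('k::finite, 'm) tensor2"
  assumes F: "smooth_torus F" "\<And>q. F q > 0" and \<epsilon>: "\<epsilon> > 0" and dims: "CARD('k) = k" "k \<ge> 2" "CARD('m) = m" "m \<ge> 1"
    and \<beta>: "\<beta> \<ge> 0" and C: "C2_norm (\<lambda>q. ln (F q)) \<le> C"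
    and pert: "\<And>x. t * \<theta> x \<le> 1 / 2" "\<And>x. norm (log_factor_grad t \<theta> x) \<le> 1"
      "\<And>x h. norm (log_factor_hess t \<theta> x h) \<le> norm h"
    and trace: "\<And>x. real k * (\<Sum>b\<in>Basis. mixed_form (grad \<phi> x) (hess \<phi> x) (- \<beta> *\<^sub>R grad \<phi> x + log_factor_grad t \<theta> x) b b)
      + (real m - 1) * (\<Sum>b\<in>Basis. conformal_form (- \<beta> *\<^sub>R grad \<phi> x + log_factor_grad t \<theta> x)
          (\<lambda>h. - \<beta> *\<^sub>R hess \<phi> x h + log_factor_hess t \<theta> x h) b b) > 0"
    and small: "\<epsilon>\<^sup>2 * ((1 + 144 * (real k + real m)) *
      (2 + (real m)\<^sup>2 * C * (1 + \<beta>) + exp (2 * C) + 2 * exp (2 * \<beta> * C)) ^ 4) \<le> 1"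
  shows "positive_intermediate_curvature m g"
proof -
  let ?f = "in_coords F"
  have f: "smooth ?f" "lattice_periodic ?f" "\<And>x. ?f x > 0"
    using F lattice_periodic_in_coords by (auto simp: smooth_torus_def in_coords_def)
  have \<phi>: "smooth \<phi>" unfolding \<phi>_def by (rule smooth_ln[OF f(1,3)])
  have \<theta>: "smooth \<theta>" "lattice_periodic \<theta>"
    unfolding \<theta>_def by (rule smooth_grad_sq[OF f(1)], rule lattice_periodic_grad_sq[OF f(1,2)])
  have \<theta>1: "t * \<theta> x < 1" for x using pert(1)[of x] by linarith
  define \<psi> where "\<psi> x = - \<beta> * \<phi> x + ln (1 - t * \<theta> x) / 2" for x
  have exp\<psi>: "exp (2 * \<psi> x) = ?f x powr (- 2 * \<beta>) * (1 - t * \<theta> x)" for x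
  proof -
    have "2 * \<psi> x = - 2 * \<beta> * \<phi> x + ln (1 - t * \<theta> x)" by (simp add: \<psi>_def)
    then have "exp (2 * \<psi> x) = exp (- 2 * \<beta> * \<phi> x) * exp (ln (1 - t * \<theta> x))" by (simp only: exp_add)
    then show ?thesis using f(3)[of x] \<theta>1[of x] by (simp add: \<phi>_def powr_def)
  qed
  interpret doubly_warped "log_stereo_factor \<epsilon> :: real^'k \<Rightarrow> real" \<phi> \<psi>
    "\<lambda>y. - (2 / (1 + y \<bullet> y)) *\<^sub>R y" "\<lambda>y h. (4 * (y \<bullet> h) / (1 + y \<bullet> y)\<^sup>2) *\<^sub>R y - (2 / (1 + y \<bullet> y)) *\<^sub>R h"
    "grad \<phi>" "hess \<phi>"
    "\<lambda>x. - \<beta> *\<^sub>R grad \<phi> x + log_factor_grad t \<theta> x"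
    "\<lambda>x h. - \<beta> *\<^sub>R hess \<phi> x h + log_factor_hess t \<theta> x h"
  proof
    show "(\<psi> has_derivative (\<lambda>h. (- \<beta> *\<^sub>R grad \<phi> x + log_factor_grad t \<theta> x) \<bullet> h)) (at x)" for x
      unfolding \<psi>_def[abs_def]
      by (rule has_derivative_eq_rhs[OF has_derivative_add[OF has_derivative_mult_right[OF has_derivative_grad[OF \<phi>]]
            has_derivative_log_factor[OF \<theta>(1) \<theta>1]]]) (simp add: inner_diff_left fun_eq_iff)
    show "((\<lambda>x. - \<beta> *\<^sub>R grad \<phi> x + log_factor_grad t \<theta> x) has_derivative
        (\<lambda>h. - \<beta> *\<^sub>R hess \<phi> x h + log_factor_hess t \<theta> x h)) (at x)" for x
      by (intro has_derivative_add has_derivative_scaleR_right has_derivative_hess[OF \<phi>]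
          has_derivative_log_factor_grad \<theta> \<theta>1)
  qed (rule has_derivative_log_stereo_factor[OF \<epsilon>] has_derivative_grad[OF \<phi>]
      has_derivative_grad_log_stereo_factor has_derivative_hess[OF \<phi>])+
  have pull: "pullback s g = G" if s: "s \<in> {1, -1}" for s
  proof (intro ext)
    fix z a b
    have q: "in_coords (\<lambda>q. F q powr (- 2 * \<beta>) + t * - (F q powr (- 2 * \<beta>) * \<theta> (rep_torus q))) (snd z) = Q z"
      unfolding Q_def exp\<psi> using fun_cong[OF in_coords_rep[OF \<theta>(2)], of "snd z"]
      by (simp add: in_coords_def algebra_simps)
    have "exp (2 * \<phi> (snd z)) = (?f (snd z))\<^sup>2"
      unfolding \<phi>_def using f(3)[of "snd z"] by (simp add: exp_double)
    then have p: "in_coords (\<lambda>q. \<epsilon>\<^sup>2 * (F q)\<^sup>2) (snd z) * (4 / (1 + fst z \<bullet> fst z)\<^sup>2) = P z"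
      unfolding P_def distrib_left exp_add exp_log_stereo_factor[OF \<epsilon>] by (simp add: in_coords_def)
    show "pullback s g z a b = G z a b"
      unfolding g_def pullback_warped_tensor[OF s] q p G_def ..
  qed
  have log_coords: "in_coords (\<lambda>q. ln (F q)) = \<phi>" by (simp add: in_coords_def \<phi>_def fun_eq_iff)
  have Cb: "\<bar>iter_deriv vs \<phi> x\<bar> \<le> C" if "set vs \<subseteq> Basis" "length vs \<le> 2" for vs x
    using order_trans[OF iter_deriv_le_C2_norm C] \<phi> that log_coords by (metis smooth_torus_def)
  \<comment> \<open>The empty list of directions gives \<open>\<phi>\<close> itself.\<close>
  have C0: "\<bar>\<phi> x\<bar> \<le> C" for x using Cb[of "[]" x] by simp
  have Cpos: "0 \<le> C" using C0[of 0] by linarith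
  define M where "M = 2 + (real m)\<^sup>2 * C * (1 + \<beta>) + exp (2 * C) + 2 * exp (2 * \<beta> * C)"
  define L where "L = (real m)\<^sup>2 * C"
  have L0: "0 \<le> L" "0 \<le> \<beta> * L" unfolding L_def using Cpos \<beta> by auto
  have e0: "0 < exp (2 * C)" "0 < exp (2 * \<beta> * C)" by auto
  have M_eq: "M = 2 + L + \<beta> * L + exp (2 * C) + 2 * exp (2 * \<beta> * C)"
    unfolding M_def L_def by (simp add: algebra_simps)
  have M: "1 \<le> M" "L \<le> M" "1 + \<beta> * L \<le> M" "exp (2 * C) \<le> M" "2 * exp (2 * \<beta> * C) \<le> M"
    unfolding M_eq using L0 e0 by linarith+
  have gL: "norm (grad \<phi> x) \<le> L" for x
  proof -
    have "norm (grad \<phi> x) \<le> real m * C"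
      using norm_grad_le[of \<phi> x C] Cb[of "[_]" x] dims by simp
    also have "\<dots> \<le> L" unfolding L_def power2_eq_square
      using mult_right_mono[of 1 "real m" "real m * C"] dims Cpos by (simp add: mult.assoc)
    finally show ?thesis .
  qed
  have hL: "norm (hess \<phi> x h) \<le> L * norm h" for x h
    using norm_hess_le[OF \<phi>, of x C h] Cb[of "[_, _]" x] dims unfolding L_def by simp
  have gq: "norm (- \<beta> *\<^sub>R grad \<phi> x + log_factor_grad t \<theta> x) \<le> M" for x
  proof -
    have "norm (- \<beta> *\<^sub>R grad \<phi> x + log_factor_grad t \<theta> x) \<le> \<beta> * norm (grad \<phi> x) + norm (log_factor_grad t \<theta> x)"
      using norm_triangle_ineq[of "- \<beta> *\<^sub>R grad \<phi> x" "log_factor_grad t \<theta> x"] \<beta> by simp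
    also have "\<dots> \<le> \<beta> * L + 1"
      using mult_left_mono[OF gL[of x] \<beta>] pert(2)[of x] by linarith
    finally show ?thesis using M(3) by linarith
  qed
  have hq: "norm (- \<beta> *\<^sub>R hess \<phi> x h + log_factor_hess t \<theta> x h) \<le> M * norm h" for x h
  proof -
    have "norm (- \<beta> *\<^sub>R hess \<phi> x h + log_factor_hess t \<theta> x h) \<le> \<beta> * norm (hess \<phi> x h) + norm (log_factor_hess t \<theta> x h)"
      using norm_triangle_ineq[of "- \<beta> *\<^sub>R hess \<phi> x h" "log_factor_hess t \<theta> x h"] \<beta> by simp
    also have "\<dots> \<le> \<beta> * (L * norm h) + norm h"
      using mult_left_mono[OF hL[of x h] \<beta>] pert(3)[of x h] by linarith
    also have "\<dots> = (1 + \<beta> * L) * norm h" by (simp add: algebra_simps)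
    also have "\<dots> \<le> M * norm h" using M(3) by (intro mult_right_mono) auto
    finally show ?thesis .
  qed
  have e\<phi>: "exp (2 * \<phi> x) \<le> M" for x
  proof -
    have "exp (2 * \<phi> x) \<le> exp (2 * C)" using C0[of x] by simp
    then show ?thesis using M(4) by linarith
  qed
  have e\<psi>: "exp (- 2 * \<psi> x) \<le> M" for x
  proof -
    have u: "1 / 2 \<le> 1 - t * \<theta> x" using pert(1)[of x] by linarith
    have "exp (- 2 * \<psi> x) = exp (2 * \<beta> * \<phi> x) / (1 - t * \<theta> x)"
      using \<theta>1[of x] unfolding \<psi>_def by (simp add: algebra_simps exp_diff)
    also have "\<dots> \<le> exp (2 * \<beta> * C) / (1 / 2)"
    proof (rule frac_le)
      have "\<beta> * \<phi> x \<le> \<beta> * C" using C0[of x] by (intro mult_left_mono \<beta>) auto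
      then show "exp (2 * \<beta> * \<phi> x) \<le> exp (2 * \<beta> * C)" by simp
    qed (use u in auto)
    finally show ?thesis using M(5) by simp
  qed
  show ?thesis
    unfolding positive_intermediate_curvature_def
  proof (intro ballI allI impI)
    fix s :: real and z e
    assume s: "s \<in> {1, -1}" and e: "orthonormal_frame (pullback s g) z e"
    show "0 < intermediate_curvature m (pullback s g) z e"
      unfolding pull[OF s]
    proof (rule frame_curvature_pos[where k = k and \<epsilon> = \<epsilon> and M = M])
      show "norm (hess \<phi> (snd z) h) \<le> M * norm h" for h
        using order_trans[OF hL mult_right_mono[OF M(2)]] by simp
      show "orthonormal_frame G z e" using e unfolding pull[OF s] .
      show "conformal_form (- (2 / (1 + fst z \<bullet> fst z)) *\<^sub>R fst z)
          (\<lambda>h. (4 * (fst z \<bullet> h) / (1 + fst z \<bullet> fst z)\<^sup>2) *\<^sub>R fst z - (2 / (1 + fst z \<bullet> fst z)) *\<^sub>R h) a b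
        = exp (2 * log_stereo_factor \<epsilon> (fst z)) / (2 * \<epsilon>\<^sup>2) * (a \<bullet> b)" for a b
        by (rule conformal_form_log_stereo_factor[OF \<epsilon>])
    qed (use dims \<epsilon> M(1) order_trans[OF gL M(2)] gq hq e\<phi> e\<psi> small trace in
        \<open>simp_all add: M_def[symmetric]\<close>)
  qed
qed

theorem corollary1p5:
  fixes n m :: nat
  assumes "m \<ge> 2" and "n \<ge> m + 2"
    and "int n * (int m - 2) > (int m)\<^sup>2 - 2"
    and "CARD('m::finite) = m" and "CARD('k::finite) = n - m"
  shows "\<exists>\<epsilon>\<^sub>0 :: real \<Rightarrow> real. (\<forall>c. \<epsilon>\<^sub>0 c > 0) \<and>
    (\<forall>(F :: 'm torus \<Rightarrow> real) \<epsilon>.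
       smooth_torus F \<and> (\<forall>q. F q > 0) \<and> morse_torus F \<and>
       0 < \<epsilon> \<and> \<epsilon> < \<epsilon>\<^sub>0 (C2_norm (\<lambda>q. ln (F q))) \<longrightarrow>
       (\<forall>U :: ('k, 'm) tensor2 set. Cinf_neighborhood (warped_metric n m \<epsilon> F) U \<longrightarrow>
          (\<exists>g\<in>U. riemannian_metric g \<and> positive_intermediate_curvature m g)))"
proof -
  define k where "k = n - m"
  define \<beta> where "\<beta> = real k / (real m - 1)"
  have k: "k \<ge> 2" "n = k + m" using assms(2) by (auto simp: k_def)
  have kk: "CARD('k) = k" using assms(5) by (simp add: k_def)
  have m1: "real m - 1 > 0" using assms(1) by simp
  have \<beta>0: "\<beta> \<ge> 0" unfolding \<beta>_def using m1 by simp
  have \<beta>k: "(real m - 1) * \<beta> = real k" unfolding \<beta>_def using m1 by simp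
  \<comment> \<open>The dimension condition is the positivity of the coefficient in \<open>trace_curvature_eq\<close>.\<close>
  have "int k * (int m - 2) > 2 * (int m - 1)"
    using assms(3) unfolding k(2) by (simp add: algebra_simps power2_eq_square)
  then have "real_of_int (int k * (int m - 2)) > real_of_int (2 * (int m - 1))"
    by (simp only: of_int_less_iff)
  then have \<beta>2: "(real m - 2) * \<beta> > 2"
    unfolding \<beta>_def using m1 by (simp add: pos_less_divide_eq mult.commute)
  define M where "M C = 2 + (real m)\<^sup>2 * \<bar>C\<bar> * (1 + \<beta>) + exp (2 * \<bar>C\<bar>) + 2 * exp (2 * \<beta> * \<bar>C\<bar>)" for C
  define A where "A = 1 + 144 * (real k + real m)"
  define \<epsilon>\<^sub>0 where "\<epsilon>\<^sub>0 C = 1 / (A * (M C)\<^sup>2)" for C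
  have M: "M C > 0" for C
    unfolding M_def using \<beta>0 by (intro add_pos_pos add_pos_nonneg) auto
  have A: "A \<ge> 1" unfolding A_def by simp
  have \<epsilon>\<^sub>0: "\<epsilon>\<^sub>0 C > 0" for C unfolding \<epsilon>\<^sub>0_def using M[of C] A by simp
  show ?thesis
  proof (intro exI[of _ \<epsilon>\<^sub>0] conjI allI impI)
    fix F :: "'m torus \<Rightarrow> real" and \<epsilon> :: real and U :: "('k, 'm) tensor2 set"
    assume *: "smooth_torus F \<and> (\<forall>q. F q > 0) \<and> morse_torus F \<and> 0 < \<epsilon> \<and> \<epsilon> < \<epsilon>\<^sub>0 (C2_norm (\<lambda>q. ln (F q)))"
      and U: "Cinf_neighborhood (warped_metric n m \<epsilon> F) U"
    then have F: "smooth_torus F" "\<And>q. F q > 0" "morse_torus F" and \<epsilon>: "0 < \<epsilon>" by auto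
    let ?C = "C2_norm (\<lambda>q. ln (F q))"
    have small: "\<epsilon>\<^sup>2 * (A * (M ?C) ^ 4) \<le> 1"
    proof -
      have "\<epsilon> * (A * (M ?C)\<^sup>2) < 1" using * A M[of ?C] unfolding \<epsilon>\<^sub>0_def by (simp add: pos_less_divide_eq)
      then have "(\<epsilon> * (A * (M ?C)\<^sup>2))\<^sup>2 \<le> 1\<^sup>2" using \<epsilon> A M[of ?C] by (intro power_mono) auto
      moreover have "\<epsilon>\<^sup>2 * (A * (M ?C) ^ 4) \<le> A * (\<epsilon>\<^sup>2 * (A * (M ?C) ^ 4))"
        using A M[of ?C] by (intro mult_left_mono[of 1 A, simplified mult_1_left] mult_right_mono[of 1 A, simplified]) auto
      ultimately show ?thesis by (simp add: power_mult_distrib power2_eq_square power4_eq_xxxx algebra_simps)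
    qed
    define f where "f = in_coords F"
    define \<phi> where "\<phi> x = ln (f x)" for x
    define \<theta> where "\<theta> = grad_sq f"
    have f: "smooth f" "lattice_periodic f" "\<And>x. f x > 0"
      using F lattice_periodic_in_coords by (auto simp: smooth_torus_def in_coords_def f_def)
    have \<phi>: "smooth \<phi>" "lattice_periodic \<phi>"
      using smooth_ln[OF f(1,3)] f(2) by (simp_all add: \<phi>_def[abs_def] lattice_periodic_def)
    have \<theta>: "smooth \<theta>" "lattice_periodic \<theta>" "\<And>x. \<theta> x \<ge> 0"
      unfolding \<theta>_def using smooth_grad_sq[OF f(1)] lattice_periodic_grad_sq[OF f(1,2)]
      by (auto simp: grad_sq_def intro: sum_nonneg)
    have crit: "laplacian \<theta> x > 0" if "grad \<phi> x = 0" for x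
      using laplacian_grad_sq_pos[OF F(3)] grad_ln_eq_0[OF f(1,3)] that
      unfolding \<theta>_def \<phi>_def[abs_def] f_def by blast
    obtain t1 where t1: "t1 > 0" and pert: "\<And>t x. 0 < t \<Longrightarrow> t < t1 \<Longrightarrow>
      t * \<theta> x \<le> 1 / 2 \<and> norm (log_factor_grad t \<theta> x) \<le> 1 \<and> (\<forall>h. norm (log_factor_hess t \<theta> x h) \<le> norm h) \<and>
      real k * (\<Sum>b\<in>Basis. mixed_form (grad \<phi> x) (hess \<phi> x) (- \<beta> *\<^sub>R grad \<phi> x + log_factor_grad t \<theta> x) b b)
      + (real m - 1) * (\<Sum>b\<in>Basis. conformal_form (- \<beta> *\<^sub>R grad \<phi> x + log_factor_grad t \<theta> x)
          (\<lambda>h. - \<beta> *\<^sub>R hess \<phi> x h + log_factor_hess t \<theta> x h) b b) > 0"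
      using exists_perturbation[OF \<phi> \<theta> crit, of \<beta> "real k"] m1 \<beta>k \<beta>2 k(1) assms(4) by auto
    define u where "u q = \<epsilon>\<^sup>2 * (F q)\<^sup>2" for q
    define v where "v q = F q powr (- 2 * \<beta>)" for q
    \<comment> \<open>The torus part \<open>v * (1 - t * \<theta>)\<close> is written as \<open>v + t * h\<close>.\<close>
    define h where "h q = - (v q * \<theta> (rep_torus q))" for q
    have su: "smooth_torus u"
    proof -
      have "smooth (\<lambda>x. \<epsilon>\<^sup>2 * (f x * f x))" by (intro smooth_mult smooth_const f)
      then show ?thesis by (simp add: smooth_torus_def in_coords_def[abs_def] u_def f_def power2_eq_square)
    qed
    have sv: "smooth_torus v"
    proof -
      have "in_coords v = (\<lambda>x. exp (- 2 * \<beta> * \<phi> x))"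
        using f(3) F(2) by (simp add: fun_eq_iff in_coords_def v_def \<phi>_def f_def powr_def) (metis less_irrefl)
      moreover have "smooth (\<lambda>x. exp (- 2 * \<beta> * \<phi> x))"
        by (intro smooth_exp smooth_mult smooth_const \<phi>(1))
      ultimately show ?thesis by (simp only: smooth_torus_def)
    qed
    have sh: "smooth_torus h"
    proof -
      have "in_coords h = (\<lambda>x. (- 1) * (in_coords v x * \<theta> x))"
        using fun_cong[OF in_coords_rep[OF \<theta>(2)]] by (simp add: fun_eq_iff h_def in_coords_def)
      moreover have "smooth (\<lambda>x. (- 1) * (in_coords v x * \<theta> x))"
        using sv unfolding smooth_torus_def by (intro smooth_mult smooth_const \<theta>(1))
      ultimately show ?thesis by (simp only: smooth_torus_def)
    qed
    have vh: "smooth_torus (\<lambda>q. v q + t * h q)" for t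
      using sv sh unfolding smooth_torus_def in_coords_def[abs_def] by (intro smooth_add smooth_mult smooth_const)
    obtain N K d where K: "compact K" "d > 0" "close_metrics N K d (warped_metric n m \<epsilon> F) \<subseteq> U"
      using U unfolding Cinf_neighborhood_def by blast
    have g0: "warped_metric n m \<epsilon> F = warped_tensor u v"
      unfolding warped_metric_eq u_def v_def \<beta>_def k(2) by simp
    obtain t2 where t2: "t2 > 0" and close: "\<And>t. 0 < t \<Longrightarrow> t < t2 \<Longrightarrow>
        riemannian_metric (warped_tensor u (\<lambda>q. v q + t * h q) :: ('k, 'm) tensor2) \<Longrightarrow>
        warped_tensor u (\<lambda>q. v q + t * h q) \<in> close_metrics N K d (warped_tensor u v :: ('k, 'm) tensor2)"
      using linear_perturbation_close[OF su sv sh K(1,2), of N] by blast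
    define t where "t = min t1 t2 / 2"
    have t: "0 < t" "t < t1" "t < t2" using t1 t2 by (auto simp: t_def)
    let ?g = "warped_tensor u (\<lambda>q. v q + t * h q) :: ('k, 'm) tensor2"
    have "v q + t * h q > 0" for q
    proof -
      have "v q * (1 - t * \<theta> (rep_torus q)) > 0"
        using pert[OF t(1,2), of "rep_torus q"] F(2)[of q] by (intro mult_pos_pos) (auto simp: v_def)
      then show ?thesis by (simp add: h_def algebra_simps)
    qed
    moreover have "u q > 0" for q
      unfolding u_def using \<epsilon> F(2)[of q] by (intro mult_pos_pos zero_less_power)
    ultimately have "riemannian_metric ?g"
      by (intro riemannian_metric_warped_tensor su vh)
    moreover have "positive_intermediate_curvature m ?g"
      unfolding u_def v_def h_def \<theta>_def f_def
    proof (rule perturbed_metric_positive[where C = "\<bar>?C\<bar>" and k = k])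
      show "\<epsilon>\<^sup>2 * ((1 + 144 * (real k + real m)) *
        (2 + (real m)\<^sup>2 * \<bar>?C\<bar> * (1 + \<beta>) + exp (2 * \<bar>?C\<bar>) + 2 * exp (2 * \<beta> * \<bar>?C\<bar>)) ^ 4) \<le> 1"
        using small unfolding A_def M_def .
    qed (use F \<epsilon> kk k assms(1,4) \<beta>0 pert[OF t(1,2)] in \<open>auto simp: \<phi>_def[abs_def] \<theta>_def f_def\<close>)
    ultimately show "\<exists>g\<in>U. riemannian_metric g \<and> positive_intermediate_curvature m g"
      using close[OF t(1,3)] K(3) unfolding g0 by blast
  qed (rule \<epsilon>\<^sub>0)
qed

end
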